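(* (1) Let $B_1,B_2\in SL_2(\mathbb Z)$ be noncentral finite-order matrices and suppose that $B_1B_2$ is conjugate to $U_h=\begin{pmatrix}1&h\\0&1\end{pmatrix}$ for some integer $h\ge 1$. Up to simultaneous conjugacy, interchange of the two factors, and reversal of the parabolic orientation, the only possibilities for (order of $B_1$, order of $B_2$; $h$) are $$(3,4;\,h=1),\qquad (4,6;\,h=1),\qquad (3,6;\,h=2).$$ In particular $h\le 2$. (2) Fix $s\in\mathbb Z\setminus\{0\}$ and a pair $(B_1,B_2)$ as in (1), normalized so that $B_1B_2=U_h$, with associated representation $\rho$ of $\Gamma=C_{m_1}*C_{m_2}$. For the associated rank-four parabolic Jacobi representations of scale $s$, the classes in $H^1(\Gamma,W_\rho)$ for which the logarithm of the unipotent monodromy has square zero form a lattice of rank one. If $k$ is a primitive coordinate on this lattice and $$\nu_\rho=\left|\det(I-B_1)\det(I-B_2)\right|,$$ then an integral lift of scale $s$ of the class with coordinate $k$ exists if and only if $s k^2/\nu_\rho\in\mathbb Z$. For a liftable class with $k\ne0$, the nilpotent monodromy $N=\log P$ has rank two and its image $N(V)$ has finite index $$r=\left|\frac{s k^2}{\nu_\rho}\right|$$ in its saturated image lattice $V\cap \operatorname{im}(N\otimes\mathbb Q)$. For $k=0$ the nilpotent monodromy of a lift has rank one.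
   Context: Reversal of the parabolic orientation means replacing the oriented cusp generator by its inverse, so that $U_h$ is replaced by $U_{-h}$ before renormalizing the width to be positive. Let $m_i\in\{3,4,6\}$ be the exact order of $B_i$, let $\Gamma=C_{m_1}*C_{m_2}$ be the free product of cyclic groups with generators $g_1,g_2$, let $W=\mathbb Z^2$, and let $\rho:\Gamma\to SL_2(\mathbb Z)$, $\rho(g_i)=B_i$. Write $W_\rho$ for $W$ with the action via $\rho$. A $1$-cocycle $d$ is given by $d_i=d(g_i)\in W$, and coboundaries are the pairs $((I-B_1)u,(I-B_2)u)$, $u\in W$. Put $J_s=s\begin{pmatrix}0&1\\-1&0\end{pmatrix}$ and $V=\mathbb Z\gamma\oplus W\oplus\mathbb Z\delta\cong\mathbb Z^4$. For $B\in SL_2(\mathbb Z)$, $d\in\mathbb Z^2$, $z\in\mathbb Z$ let $$T(B,d,z)=\begin{pmatrix}1&d^{\mathsf T}J_sB&z\\0&B&d\\0&0&1\end{pmatrix}\in GL(V),$$ so $T(B,d,z)T(B',d',z')=T(BB',d+Bd',z+z'+d^{\mathsf T}J_sBd')$. These matrices form the rank-four integral parabolic Jacobi group of scale $s$. An integral lift of scale $s$ of the class of $(d_1,d_2)$ is a homomorphism $\Gamma\to\{T(B,d,z)\}$ sending $g_i$ to $T_i=T(B_i,d_i,z_i)$ with $z_i\in\mathbb Z$, i.e. a choice of integers $z_1,z_2$ with $T_i^{m_i}=I$. Its unipotent (cusp) monodromy is $P=T_1T_2=T(U_h,d_1+B_1d_2,\ast)$ and $N=\log P$. The condition $N^2=0$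 (equivalently $(P-I)^2=0$) does not depend on $z_1,z_2$: it says that $d(g_1g_2)=d_1+B_1d_2$ lies in $\ker(U_h-I)$. A primitive coordinate on a rank-one lattice is an isomorphism of it with $\mathbb Z$. *)

theory Defs
  imports "HOL-Analysis.Analysis"
    "HOL-Algebra.Elementary_Groups"
    "HOL-Algebra.Multiplicative_Group"
begin

section \<open>Finite-order pairs in the integral modular group\<close>

definition SL2Z :: "(int^2^2) monoid" where
  "SL2Z = \<lparr>carrier = {A. det A = 1}, monoid.mult = (**), one = mat 1\<rparr>"

definition U_mat :: "int \<Rightarrow> int^2^2" where
  "U_mat h = vector [vector [1, h], vector [0, 1]]"

definition conjugate_SL2Z :: "int^2^2 \<Rightarrow> int^2^2 \<Rightarrow> bool" where
  "conjugate_SL2Z A B \<longleftrightarrow>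
     (\<exists>g\<in>carrier SL2Z. B = g \<otimes>\<^bsub>SL2Z\<^esub> A \<otimes>\<^bsub>SL2Z\<^esub> inv\<^bsub>SL2Z\<^esub> g)"

definition noncentral_finite_order :: "int^2^2 \<Rightarrow> bool" where
  "noncentral_finite_order B \<longleftrightarrow>
     B \<in> carrier SL2Z \<and>
     (\<exists>n::nat. n > 0 \<and> B [^]\<^bsub>SL2Z\<^esub> n = \<one>\<^bsub>SL2Z\<^esub>) \<and>
     (\<exists>A\<in>carrier SL2Z. A \<otimes>\<^bsub>SL2Z\<^esub> B \<noteq> B \<otimes>\<^bsub>SL2Z\<^esub> A)"

text \<open>Reversal of the parabolic orientation inverts the cusp generator:
  the product of \<open>(inv B2, inv B1)\<close> is the inverse of \<open>B1 B2\<close>, so a product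
  conjugate to \<open>U_mat h\<close> becomes one conjugate to \<open>U_mat (- h)\<close>. The normalized width is
  the positive one of \<open>h\<close>, \<open>- h\<close>, and none of the three moves changes it.\<close>

inductive pair_move :: "(int^2^2) \<times> (int^2^2) \<Rightarrow> (int^2^2) \<times> (int^2^2) \<Rightarrow> bool" where
  simultaneous_conjugation: "g \<in> carrier SL2Z \<Longrightarrow>
     pair_move (B1, B2)
       (g \<otimes>\<^bsub>SL2Z\<^esub> B1 \<otimes>\<^bsub>SL2Z\<^esub> inv\<^bsub>SL2Z\<^esub> g, g \<otimes>\<^bsub>SL2Z\<^esub> B2 \<otimes>\<^bsub>SL2Z\<^esub> inv\<^bsub>SL2Z\<^esub> g)"
| interchange: "pair_move (B1, B2) (B2, B1)"
| orientation_reversal: "pair_move (B1, B2) (inv\<^bsub>SL2Z\<^esub> B2, inv\<^bsub>SL2Z\<^esub> B1)"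

definition pair_equiv :: "(int^2^2) \<times> (int^2^2) \<Rightarrow> (int^2^2) \<times> (int^2^2) \<Rightarrow> bool" where
  "pair_equiv = equivclp pair_move"


section \<open>The free product of two finite cyclic groups\<close>

text \<open>Since both generators have finite order, the free product of cyclic groups of
  (positive) orders \<open>m1\<close>, \<open>m2\<close> has the monoid presentation
  \<open>\<langle>g1, g2 | g1^m1 = 1, g2^m2 = 1\<rangle>\<close>; its elements are classes of positive words.\<close>

datatype letter = G1 | G2

inductive relator_step :: "nat \<Rightarrow> nat \<Rightarrow> letter list \<Rightarrow> letter list \<Rightarrow> bool"
  for m1 m2 :: nat where
  "relator_step m1 m2 (u @ replicate m1 G1 @ v) (u @ v)"
| "relator_step m1 m2 (u @ replicate m2 G2 @ v) (u @ v)"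

definition word_class :: "nat \<Rightarrow> nat \<Rightarrow> letter list \<Rightarrow> letter list set" where
  "word_class m1 m2 w = {w'. equivclp (relator_step m1 m2) w w'}"

definition cyclic_free_product :: "nat \<Rightarrow> nat \<Rightarrow> letter list set monoid" where
  "cyclic_free_product m1 m2 =
     \<lparr>carrier = range (word_class m1 m2),
      monoid.mult = (\<lambda>C D. \<Union>x\<in>C. \<Union>y\<in>D. word_class m1 m2 (x @ y)),
      one = word_class m1 m2 []\<rparr>"


section \<open>First cohomology with coefficients in the standard lattice\<close>

definition cocycle_group :: "'g monoid \<Rightarrow> ('g \<Rightarrow> int^2^2) \<Rightarrow> ('g \<Rightarrow> int^2) monoid" where
  "cocycle_group \<Gamma> \<rho> =
     \<lparr>carrier = {d \<in> extensional (carrier \<Gamma>).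
        \<forall>x\<in>carrier \<Gamma>. \<forall>y\<in>carrier \<Gamma>. d (x \<otimes>\<^bsub>\<Gamma>\<^esub> y) = d x + \<rho> x *v d y},
      monoid.mult = (\<lambda>d e. \<lambda>x\<in>carrier \<Gamma>. d x + e x),
      one = (\<lambda>x\<in>carrier \<Gamma>. 0)\<rparr>"

definition coboundaries :: "'g monoid \<Rightarrow> ('g \<Rightarrow> int^2^2) \<Rightarrow> ('g \<Rightarrow> int^2) set" where
  "coboundaries \<Gamma> \<rho> = {(\<lambda>x\<in>carrier \<Gamma>. (mat 1 - \<rho> x) *v u) | u. True}"

definition H1 :: "'g monoid \<Rightarrow> ('g \<Rightarrow> int^2^2) \<Rightarrow> ('g \<Rightarrow> int^2) set monoid" where
  "H1 \<Gamma> \<rho> = cocycle_group \<Gamma> \<rho> Mod coboundaries \<Gamma> \<rho>"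


section \<open>The rank-four integral parabolic Jacobi group\<close>

definition J_mat :: "int \<Rightarrow> int^2^2" where
  "J_mat s = vector [vector [0, s], vector [- s, 0]]"

definition T_mat :: "int \<Rightarrow> int^2^2 \<Rightarrow> int^2 \<Rightarrow> int \<Rightarrow> int^4^4" where
  "T_mat s B d z = (let r = d v* (J_mat s ** B) in
     vector [vector [1, r$1,   r$2,   z],
             vector [0, B$1$1, B$1$2, d$1],
             vector [0, B$2$1, B$2$2, d$2],
             vector [0, 0,     0,     1]])"

definition jacobi_group :: "int \<Rightarrow> (int^4^4) monoid" where
  "jacobi_group s =
     \<lparr>carrier = {T_mat s B d z | B d z. B \<in> carrier SL2Z}, monoid.mult = (**), one = mat 1\<rparr>"

text \<open>For unipotent \<open>P\<close> of size four, \<open>(P - 1)^4 = 0\<close>, so the logarithm series stops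
  after the cubic term.\<close>

definition unipotent_log :: "int^4^4 \<Rightarrow> rat^4^4" where
  "unipotent_log P = (let A = map_matrix of_int (P - mat 1) in
     \<chi> i j. A$i$j - (A ** A)$i$j / 2 + (A ** A ** A)$i$j / 3)"

text \<open>A class need not admit an integral lift, so \<open>z1\<close>, \<open>z2\<close> are arbitrary integers here;
  whether the square vanishes depends neither on them nor on the chosen representative
  \<open>d\<close> of the class.\<close>

definition square_zero_classes ::
  "int \<Rightarrow> 'g monoid \<Rightarrow> ('g \<Rightarrow> int^2^2) \<Rightarrow> 'g \<Rightarrow> 'g \<Rightarrow> ('g \<Rightarrow> int^2) set set" where
  "square_zero_classes s \<Gamma> \<rho> g1 g2 =
     {c \<in> carrier (H1 \<Gamma> \<rho>). \<forall>d\<in>c. \<forall>z1 z2.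
        (let N = unipotent_log (T_mat s (\<rho> g1) (d g1) z1 ** T_mat s (\<rho> g2) (d g2) z2)
         in N ** N = 0)}"

definition integral_lift ::
  "int \<Rightarrow> 'g monoid \<Rightarrow> ('g \<Rightarrow> int^2^2) \<Rightarrow> 'g \<Rightarrow> 'g \<Rightarrow> ('g \<Rightarrow> int^2) set \<Rightarrow> ('g \<Rightarrow> int^4^4) \<Rightarrow> bool"
where
  "integral_lift s \<Gamma> \<rho> g1 g2 c \<phi> \<longleftrightarrow>
     \<phi> \<in> hom \<Gamma> (jacobi_group s) \<and>
     (\<exists>d\<in>c. \<exists>z1 z2. \<phi> g1 = T_mat s (\<rho> g1) (d g1) z1 \<and> \<phi> g2 = T_mat s (\<rho> g2) (d g2) z2)"


section \<open>Lattices in rational four-space\<close>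

definition V_lattice :: "(rat^4) set" where
  "V_lattice = {v. \<forall>i. v$i \<in> \<int>}"

definition image_lattice :: "rat^4^4 \<Rightarrow> (rat^4) set" where
  "image_lattice N = (\<lambda>v. N *v v) ` V_lattice"

definition saturated_image_lattice :: "rat^4^4 \<Rightarrow> (rat^4) set" where
  "saturated_image_lattice N = V_lattice \<inter> range (\<lambda>v. N *v v)"

definition additive_group_on :: "'a::ab_group_add set \<Rightarrow> 'a monoid" where
  "additive_group_on L = \<lparr>carrier = L, monoid.mult = (+), one = 0\<rparr>"

definition has_finite_index :: "'a set \<Rightarrow> ('a, 'm) monoid_scheme \<Rightarrow> nat \<Rightarrow> bool" where
  "has_finite_index H G r \<longleftrightarrow>
     subgroup H G \<and> finite (rcosets\<^bsub>G\<^esub> H) \<and> card (rcosets\<^bsub>G\<^esub> H) = r"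

end

theory Submission
  imports Defs
begin

text \<open>A finite-order noncentral \<open>B\<close> has trace \<open>t\<close> with \<open>|t| \<le> 1\<close>. If \<open>B1 B2 = U_h\<close> and \<open>c\<close> is the
  lower left entry of \<open>B2\<close>, then \<open>c h = t2 - t1\<close>, and \<open>c\<close> is odd when \<open>t1\<close>, \<open>t2\<close> are odd; hence
  \<open>c = \<plusminus>1\<close>, which leaves three types.

  Put \<open>n_i = det (1 - B_i) = 2 - t_i\<close>; the two are coprime. On square-zero cocycles the
  linear forms \<open>l1(d1)\<close>, \<open>l2(d2)\<close> give \<open>d(g1 g2) = (l1 + l2, 0)\<close>, and \<open>\<kappa> = n2 l1 + n1 l2\<close> is onto
  the integers with kernel the coboundaries, so \<open>\<kappa>\<close> is the coordinate \<open>k\<close> up to sign. The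
  relation \<open>T_i^(m_i) = 1\<close> means \<open>n_i z_i = s Q_i(d_i)\<close> for the quadratic form
  \<open>Q_i(d) = (adj(1 - B_i) d) \<and> d\<close>, which is \<open>\<plusminus>l_i^2\<close> modulo \<open>n_i\<close>; so both \<open>z_i\<close> are integral
  iff \<open>n1 n2\<close> divides \<open>s k^2\<close>. The nonzero \<open>2 \<times> 2\<close> block of \<open>N = P - 1\<close> has rows
  \<open>(s p, z)\<close>, \<open>(h, p)\<close>, and its determinant is \<open>s k^2 / (n1 n2)\<close>.\<close>

section \<open>Elliptic pairs with parabolic product\<close>

lemma mat2_eq_iff:
  fixes A B :: "'a^2^2"
  shows "A = B \<longleftrightarrow> A$1$1 = B$1$1 \<and> A$1$2 = B$1$2 \<and> A$2$1 = B$2$1 \<and> A$2$2 = B$2$2"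
  by (auto simp: vec_eq_iff forall_2)

lemma vec2_eq_iff: "v = w \<longleftrightarrow> v$1 = w$1 \<and> v$2 = w$2" for v w :: "'a^2"
  by (auto simp: vec_eq_iff forall_2)

lemma mult2_nth: "(A ** B)$i$j = A$i$1 * B$1$j + A$i$2 * B$2$j" for A B :: "int^2^2"
  by (simp add: matrix_matrix_mult_def sum_2)

lemma mulv2_nth: "(A *v v)$i = A$i$1 * v$1 + A$i$2 * v$2" for A :: "int^2^2"
  by (simp add: matrix_vector_mult_def sum_2)

lemma trace2: "trace A = A$1$1 + A$2$2" for A :: "int^2^2"
  by (simp add: trace_def sum_2)

lemma mat1_nth2 [simp]:
  "(mat 1 :: int^2^2)$1$1 = 1" "(mat 1 :: int^2^2)$1$2 = 0"
  "(mat 1 :: int^2^2)$2$1 = 0" "(mat 1 :: int^2^2)$2$2 = 1"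
  by (simp_all add: mat_def)

lemma U_mat_nth [simp]:
  "U_mat h$1$1 = 1" "U_mat h$1$2 = h" "U_mat h$2$1 = 0" "U_mat h$2$2 = 1"
  by (simp_all add: U_mat_def)

lemmas mat2_simps = mat2_eq_iff vec2_eq_iff mult2_nth mulv2_nth trace2 det_2

lemma carrier_SL2Z [simp]: "A \<in> carrier SL2Z \<longleftrightarrow> det A = 1"
  and mult_SL2Z [simp]: "A \<otimes>\<^bsub>SL2Z\<^esub> B = A ** B"
  and one_SL2Z [simp]: "\<one>\<^bsub>SL2Z\<^esub> = mat 1"
  by (simp_all add: SL2Z_def)

text \<open>The adjugate. It inverts matrices of determinant one; applied to
  \<open>mat 1 - B\<close> it inverts up to the factor \<open>det (mat 1 - B)\<close>, which keeps
  later arguments integral.\<close>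

definition adj2 :: "int^2^2 \<Rightarrow> int^2^2" where
  "adj2 A = vector [vector [A$2$2, - A$1$2], vector [- A$2$1, A$1$1]]"

lemma adj2_nth [simp]:
  "adj2 A$1$1 = A$2$2" "adj2 A$1$2 = - A$1$2" "adj2 A$2$1 = - A$2$1" "adj2 A$2$2 = A$1$1"
  by (simp_all add: adj2_def)

lemma group_SL2Z: "group SL2Z"
proof (rule groupI)
  fix A assume "A \<in> carrier SL2Z"
  then show "\<exists>B\<in>carrier SL2Z. B \<otimes>\<^bsub>SL2Z\<^esub> A = \<one>\<^bsub>SL2Z\<^esub>"
    by (intro bexI[of _ "adj2 A"]) (auto simp: mat2_simps algebra_simps)
qed (auto simp: det_mul matrix_mul_assoc)

interpretation SL2Z: group SL2Z
  by (rule group_SL2Z)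

lemma cayley_hamilton2:
  assumes "det (B :: int^2^2) = 1"
  shows "(B ** B)$i$j = trace B * B$i$j - mat 1$i$j"
proof -
  have "B$1$1 * B$2$2 = 1 + B$1$2 * B$2$1"
    using assms by (simp add: det_2)
  then have "\<forall>i j. (B ** B)$i$j = trace B * B$i$j - mat 1$i$j"
    by (simp add: forall_2 mult2_nth trace2 algebra_simps)
  then show ?thesis by blast
qed

text \<open>If the trace is at least two in absolute value, the coefficients of
  \<open>B^n = p B - q\<close> grow, so \<open>B^n = 1\<close> forces \<open>B\<close> to be scalar.\<close>

lemma noncentral_finite_order_trace:
  assumes "noncentral_finite_order B"
  shows "det B = 1" "\<bar>trace B\<bar> \<le> 1"
proof -
  show d: "det B = 1" using assms by (simp add: noncentral_finite_order_def)
  show "\<bar>trace B\<bar> \<le> 1"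
  proof (rule ccontr)
    assume "\<not> \<bar>trace B\<bar> \<le> 1"
    then have t: "2 \<le> \<bar>trace B\<bar>" by simp
    \<comment> \<open>Multiplication by \<open>B\<close> sends \<open>(p, q)\<close> to
      \<open>(p * trace B - q, p)\<close>, and \<open>|q| < |p|\<close> survives because
      \<open>2 * |p| - |q| > |p|\<close>.\<close>
    have pow: "\<exists>p q. \<bar>q\<bar> < \<bar>p\<bar> \<and> (\<forall>i j. (B [^]\<^bsub>SL2Z\<^esub> Suc n)$i$j = p * B$i$j - q * mat 1$i$j)" for n
    proof (induction n)
      case 0
      then show ?case using d by (intro exI[of _ 1] exI[of _ 0]) simp
    next
      case (Suc n)
      then obtain p q where pq: "\<bar>q\<bar> < \<bar>p\<bar>"
        and B: "\<And>i j. (B [^]\<^bsub>SL2Z\<^esub> Suc n)$i$j = p * B$i$j - q * mat 1$i$j" by blast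
      have "\<bar>p * trace B\<bar> \<ge> 2 * \<bar>p\<bar>"
        using mult_left_mono[OF t, of "\<bar>p\<bar>"] by (simp add: abs_mult mult.commute)
      then have "\<bar>p\<bar> < \<bar>p * trace B - q\<bar>" using pq by linarith
      moreover have "(B [^]\<^bsub>SL2Z\<^esub> Suc (Suc n))$i$j = (p * trace B - q) * B$i$j - p * mat 1$i$j" for i j
      proof -
        have "(B [^]\<^bsub>SL2Z\<^esub> Suc (Suc n))$i$j = p * (B ** B)$i$j - q * (mat 1 ** B)$i$j"
          unfolding SL2Z.nat_pow_Suc[of B "Suc n"] mult_SL2Z mult2_nth B
          by (simp add: algebra_simps)
        then show ?thesis
          by (simp only: cayley_hamilton2[OF d] matrix_mul_lid) (simp add: algebra_simps)
      qed
      ultimately show ?case by blast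
    qed
    obtain n where "n > 0" "B [^]\<^bsub>SL2Z\<^esub> (n::nat) = mat 1"
      using assms by (auto simp: noncentral_finite_order_def)
    then obtain m where m: "B [^]\<^bsub>SL2Z\<^esub> Suc m = mat 1"
      by (metis gr0_conv_Suc)
    obtain p q where "\<bar>q\<bar> < \<bar>p\<bar>"
      and B: "\<And>i j. (mat 1 :: int^2^2)$i$j = p * B$i$j - q * mat 1$i$j"
      using pow[of m] unfolding m by blast
    then have "p \<noteq> 0" by auto
    moreover have "p * B$1$1 - q = 1" "p * B$2$2 - q = 1"
      using B[of 1 1] B[of 2 2] by simp_all
    then have "p * B$1$1 = p * B$2$2" by linarith
    ultimately have "B$1$2 = 0" "B$2$1 = 0" "B$1$1 = B$2$2"
      using B[of 1 2] B[of 2 1] by simp_all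
    then show False
      using assms by (auto simp: noncentral_finite_order_def mat2_simps algebra_simps)
  qed
qed

lemma mult2_uminus [simp]: "(- A) ** B = - (A ** B)" "A ** (- B) = - (A ** B)"
  for A B :: "int^2^2"
  by (simp_all add: mat2_simps)

text \<open>By Cayley-Hamilton \<open>B\<close> is a root of the cyclotomic polynomial of index 3, 4
  or 6, whence \<open>B^3 = 1\<close>, \<open>B^2 = -1\<close> or \<open>B^3 = -1\<close>
  respectively.\<close>

lemma ord_of_trace:
  assumes d: "det B = 1"
  shows "trace B = -1 \<Longrightarrow> SL2Z.ord B = 3"
    and "trace B = 0 \<Longrightarrow> SL2Z.ord B = 4"
    and "trace B = 1 \<Longrightarrow> SL2Z.ord B = 6"
proof -
  note sq = cayley_hamilton2[OF d]
  have pow: "B [^]\<^bsub>SL2Z\<^esub> (2::nat) = B ** B" "B [^]\<^bsub>SL2Z\<^esub> (3::nat) = B ** B ** B"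
     "B [^]\<^bsub>SL2Z\<^esub> (4::nat) = (B ** B) ** (B ** B)"
     "B [^]\<^bsub>SL2Z\<^esub> (6::nat) = (B ** B ** B) ** (B ** B ** B)"
    using d by (simp_all add: numeral_eq_Suc matrix_mul_assoc)
  have ord_dvd: "SL2Z.ord B dvd n \<longleftrightarrow> B [^]\<^bsub>SL2Z\<^esub> n = mat 1" for n
    using SL2Z.pow_eq_id[of B n] d by simp
  have ne1: "B \<noteq> mat 1" if "trace B \<noteq> 2" using that by (auto simp: trace2)
  have ord1: "SL2Z.ord B \<noteq> 1" if "trace B \<noteq> 2"
    using ord_dvd[of 1] ne1[OF that] d by auto
  show "SL2Z.ord B = 3" if t: "trace B = -1"
  proof -
    have s: "B ** B = - B - mat 1" by (simp add: mat2_eq_iff sq t del: mult2_nth)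
    have "B ** B ** B = (- B - mat 1) ** B" by (simp only: s)
    also have "\<dots> = - (B ** B) - B" by (simp add: mat2_simps algebra_simps)
    also have "\<dots> = mat 1" unfolding s by simp
    finally have "SL2Z.ord B dvd 3" using ord_dvd pow by simp
    moreover have "prime (3::nat)" by simp
    ultimately show ?thesis using ord1 t prime_nat_iff by force
  qed
  show "SL2Z.ord B = 4" if t: "trace B = 0"
  proof -
    have s: "B ** B = - mat 1" by (simp add: mat2_eq_iff sq t)
    have "SL2Z.ord B dvd 4" "\<not> SL2Z.ord B dvd 2"
      unfolding ord_dvd pow s by (auto simp: mat2_eq_iff)
    moreover have "SL2Z.ord B \<le> 4" using \<open>SL2Z.ord B dvd 4\<close> by (simp add: dvd_imp_le)
    \<comment> \<open>Among these values only 4 divides 4 without dividing 2; the value 0 drops out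
      because it divides only 0.\<close>
    then have "SL2Z.ord B \<in> {0, 1, 2, 3, 4}" by auto
    ultimately show ?thesis by auto
  qed
  show "SL2Z.ord B = 6" if t: "trace B = 1"
  proof -
    have s: "B ** B = B - mat 1" by (simp add: mat2_eq_iff sq t)
    have "B ** B ** B = (B - mat 1) ** B" by (simp only: s)
    also have "\<dots> = B ** B - B" by (simp add: mat2_simps algebra_simps)
    also have "\<dots> = - mat 1" unfolding s by simp
    finally have c: "B ** B ** B = - mat 1" .
    have n3: "\<not> SL2Z.ord B dvd 3" and d6: "SL2Z.ord B dvd 6"
      unfolding ord_dvd pow c by (auto simp: mat2_eq_iff)
    have n2: "\<not> SL2Z.ord B dvd 2"
      unfolding ord_dvd pow s using t by (auto simp: mat2_eq_iff trace2)
    have "SL2Z.ord B \<le> 6" using d6 by (simp add: dvd_imp_le)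
    then have "SL2Z.ord B \<in> {0, 1, 2, 3, 4, 5, 6}" by auto
    then show ?thesis using n2 n3 d6 by auto
  qed
qed

text \<open>The entries of the two factors depend only on the two traces, the sign \<open>c\<close> and the
  free parameter \<open>a\<close>; conjugation by upper unitriangular matrices moves \<open>a\<close>.\<close>

lemma elliptic_pair_normal_form:
  assumes d: "det B1 = 1" "det B2 = 1"
    and t: "\<bar>trace B1\<bar> \<le> 1" "\<bar>trace B2\<bar> \<le> 1"
    and U: "B1 ** B2 = U_mat h" and h: "h \<ge> 1"
  obtains a c where
    "(trace B1, trace B2, h, c) \<in>
       {(-1,0,1,1), (0,-1,1,-1), (0,1,1,1), (1,0,1,-1), (-1,1,2,1), (1,-1,2,-1)}"
    "B1$1$1 = trace B1 - a" "B1$1$2 = c * (1 - a * (trace B1 - a))" "B1$2$1 = - c" "B1$2$2 = a"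
    "B2$1$1 = a" "B2$1$2 = a * h - c * (1 - a * (trace B1 - a))" "B2$2$1 = c"
    "B2$2$2 = trace B2 - a"
proof -
  \<comment> \<open>The signs make \<open>a\<close>, \<open>b\<close>, \<open>c\<close>,
    \<open>s - a\<close> the entries of the inverse of \<open>B1\<close>; multiplying it by
    \<open>U_mat h\<close> keeps the first column \<open>(a, c)\<close>.\<close>
  define a where "a = B1$2$2"
  define b where "b = - B1$1$2"
  define c where "c = - B1$2$1"
  define s where "s = trace B1"
  have B11: "B1$1$1 = s - a" by (simp add: s_def a_def trace2)
  have bc: "a * (s - a) - b * c = 1"
    using d(1) by (simp add: det_2 B11 a_def b_def c_def algebra_simps)
  have B2: "B2 = adj2 B1 ** U_mat h"
  proof -
    have "adj2 B1 ** B1 = mat 1" using d by (simp add: mat2_simps algebra_simps)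
    then show ?thesis by (metis U matrix_mul_assoc matrix_mul_lid)
  qed
  then have B2n: "B2$1$1 = a" "B2$1$2 = a * h + b" "B2$2$1 = c" "B2$2$2 = c * h + s - a"
    by (simp_all add: mult2_nth B11 a_def b_def c_def)
  then have ch: "c * h = trace B2 - s" by (simp add: trace2)
  \<comment> \<open>With \<open>c = 0\<close> the matrix \<open>B1\<close> is triangular with
    diagonal entries of product one, so its trace is 2 or -2.\<close>
  have c0: "c \<noteq> 0"
  proof
    assume "c = 0"
    then have "a * (s - a) = 1" using bc by simp
    then have "s = 2 * a \<and> \<bar>a\<bar> = 1" by (auto simp: zmult_eq_1_iff)
    then show False using t by (auto simp: s_def)
  qed
  have "s \<in> {-1, 0, 1}" using t by (auto simp: s_def)
  moreover have "\<bar>c\<bar> * h \<le> 2"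
  proof -
    have "\<bar>c\<bar> * h = \<bar>c * h\<bar>" using h by (simp add: abs_mult)
    then show ?thesis using ch t by (auto simp: s_def)
  qed
  moreover have "\<bar>c\<bar> * 1 \<le> \<bar>c\<bar> * h" by (rule mult_left_mono) (use h in auto)
  moreover have "1 * h \<le> \<bar>c\<bar> * h" by (rule mult_right_mono) (use h c0 in auto)
  ultimately have "\<bar>c\<bar> \<le> 2" "h \<le> 2" "s \<in> {-1, 0, 1}"
    by linarith+
  then have "c \<in> {-2, -1, 1, 2}" "h \<in> {1, 2}" "s \<in> {-1, 0, 1}"
    using c0 h by auto
  \<comment> \<open>The equation \<open>c * h = trace B2 - s\<close> has eight solutions in this
    range; parity removes the last two, where \<open>|c| = 2\<close>.\<close>
  moreover have "trace B2 = s + c * h" using ch by simp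
  ultimately have cases: "(s, trace B2, h, c) \<in>
       {(-1,0,1,1), (0,-1,1,-1), (0,1,1,1), (1,0,1,-1), (-1,1,2,1), (1,-1,2,-1),
        (-1,1,1,2), (1,-1,1,-2)}"
    using t(2) by - (elim insertE emptyE; simp)
  \<comment> \<open>For odd \<open>s\<close> the product \<open>a * (s - a)\<close> is even, so
    \<open>b * c = a * (s - a) - 1\<close> is odd.\<close>
  have "odd c" if "s = 1 \<or> s = -1"
  proof
    assume "even c"
    then have "even (b * c)" by simp
    moreover have "even (a * (s - a))" using that by (elim disjE) simp_all
    ultimately have "even (a * (s - a) - b * c)" by (rule dvd_diff[rotated])
    then show False unfolding bc by simp
  qed
  from cases this have "(s, trace B2, h, c) \<in>
       {(-1,0,1,1), (0,-1,1,-1), (0,1,1,1), (1,0,1,-1), (-1,1,2,1), (1,-1,2,-1)}"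
    by - (elim insertE emptyE; simp)
  \<comment> \<open>Since \<open>c\<close> is its own inverse, the determinant equation can be
    solved for \<open>b\<close>.\<close>
  moreover have b: "b = - (c * (1 - a * (s - a)))"
  proof -
    have "c * c = 1" using calculation by auto
    then have "b = c * (b * c)" by (simp add: mult.left_commute)
    also have "b * c = - (1 - a * (s - a))" using bc by simp
    finally show ?thesis by (simp only: mult_minus_right)
  qed
  moreover have "B1$2$1 = - c" "B1$2$2 = a" by (simp_all add: a_def c_def)
  moreover have "B1$1$2 = c * (1 - a * (s - a))" using b by (simp add: b_def)
  moreover have "B2$1$2 = a * h - c * (1 - a * (s - a))" using b B2n(2) by linarith
  moreover have "B2$2$2 = trace B2 - a" using ch B2n(4) by linarith
  ultimately show thesis
    using B11 B2n(1,3) by - (rule that[folded s_def, of c a], assumption+)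
qed

lemma ord_pos:
  assumes "det B = 1" "\<bar>trace B\<bar> \<le> 1"
  shows "SL2Z.ord B > 0"
proof -
  have "trace B = -1 \<or> trace B = 0 \<or> trace B = 1" using assms(2) by linarith
  then show ?thesis using ord_of_trace[OF assms(1)] by (elim disjE) simp_all
qed

text \<open>Finite order comes from the trace. A central matrix commutes with \<open>U_mat 1\<close>
  and its transpose, hence is scalar, and a scalar matrix of determinant one has trace 2 or
  -2.\<close>

lemma noncentral_finite_orderI:
  assumes d: "det B = 1" and t: "\<bar>trace B\<bar> \<le> 1"
  shows "noncentral_finite_order B"
proof -
  have "SL2Z.ord B > 0" using d t by (rule ord_pos)
  moreover have "B [^]\<^bsub>SL2Z\<^esub> SL2Z.ord B = mat 1" using SL2Z.pow_ord_eq_1[of B] d by simp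
  moreover have "\<exists>A\<in>carrier SL2Z. A \<otimes>\<^bsub>SL2Z\<^esub> B \<noteq> B \<otimes>\<^bsub>SL2Z\<^esub> A"
  proof (rule ccontr)
    assume *: "\<not> ?thesis"
    then have "U_mat 1 ** B = B ** U_mat 1" "transpose (U_mat 1) ** B = B ** transpose (U_mat 1)"
      by (simp_all add: det_2 transpose_def)
    then have "B$1$2 = 0" "B$2$1 = 0" "B$1$1 = B$2$2"
      by (simp_all add: mat2_simps transpose_def)
    then have "B$2$2 * B$2$2 = 1" "\<bar>B$2$2 + B$2$2\<bar> \<le> 1" using d t by (simp_all add: det_2 trace2)
    then show False by (auto simp: zmult_eq_1_iff)
  qed
  ultimately show ?thesis using d by (auto simp: noncentral_finite_order_def)
qed

lemma trace_conj2:
  assumes "det (g :: int^2^2) = 1"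
  shows "trace (g ** B ** inv\<^bsub>SL2Z\<^esub> g) = trace B" "det (g ** B ** inv\<^bsub>SL2Z\<^esub> g) = det B"
proof -
  have i: "inv\<^bsub>SL2Z\<^esub> g ** g = mat 1" using SL2Z.l_inv[of g] assms by simp
  have "trace (g ** B ** inv\<^bsub>SL2Z\<^esub> g) = trace (inv\<^bsub>SL2Z\<^esub> g ** (g ** B))"
    by (rule trace_mul_sym)
  then show "trace (g ** B ** inv\<^bsub>SL2Z\<^esub> g) = trace B" by (simp add: matrix_mul_assoc i)
  have "det (inv\<^bsub>SL2Z\<^esub> g) = 1" using SL2Z.inv_closed[of g] assms by simp
  then show "det (g ** B ** inv\<^bsub>SL2Z\<^esub> g) = det B" by (simp add: det_mul assms)
qed

text \<open>Conjugating both factors by the same \<open>g\<close> makes the product equal to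
  \<open>U_mat h\<close> and keeps the traces. The six types of the normal form then give three
  pairs of orders, each in both arrangements.\<close>

lemma elliptic_pair_classification:
  assumes B: "noncentral_finite_order B1" "noncentral_finite_order B2" and h: "h \<ge> 1"
    and conj: "conjugate_SL2Z (B1 ** B2) (U_mat h)"
  shows "(SL2Z.ord B1, SL2Z.ord B2, h) \<in> {(3, 4, 1), (4, 6, 1), (3, 6, 2)} \<or>
         (SL2Z.ord B2, SL2Z.ord B1, h) \<in> {(3, 4, 1), (4, 6, 1), (3, 6, 2)}"
proof -
  note d = noncentral_finite_order_trace[OF B(1)] noncentral_finite_order_trace[OF B(2)]
  obtain g where g: "det g = 1" and U: "U_mat h = g ** (B1 ** B2) ** inv\<^bsub>SL2Z\<^esub> g"
    using conj by (auto simp: conjugate_SL2Z_def)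
  let ?C = "\<lambda>B. g ** B ** inv\<^bsub>SL2Z\<^esub> g"
  have i: "inv\<^bsub>SL2Z\<^esub> g ** g = mat 1" using SL2Z.l_inv[of g] g by simp
  have "?C B1 ** ?C B2 = g ** B1 ** (inv\<^bsub>SL2Z\<^esub> g ** g) ** B2 ** inv\<^bsub>SL2Z\<^esub> g"
    by (simp only: matrix_mul_assoc)
  also have "\<dots> = U_mat h" by (simp add: i U matrix_mul_assoc)
  finally have "?C B1 ** ?C B2 = U_mat h" .
  note normal_form = elliptic_pair_normal_form[OF _ _ _ _ this h, unfolded trace_conj2[OF g], OF d(1,3,2,4)]
  have "\<exists>c::int. (trace B1, trace B2, h, c) \<in>
       {(-1,0,1,1), (0,-1,1,-1), (0,1,1,1), (1,0,1,-1), (-1,1,2,1), (1,-1,2,-1)}"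
    by (rule normal_form) (rule exI)
  then show ?thesis
    using ord_of_trace[OF d(1)] ord_of_trace[OF d(3)] by - (elim exE insertE emptyE; simp)
qed

lemma elliptic_pair_examples:
  assumes "(m1, m2, h) \<in> {(3, 4, 1), (4, 6, 1), (3, 6, 2)}"
  shows "\<exists>B1 B2. noncentral_finite_order B1 \<and> noncentral_finite_order B2 \<and>
          conjugate_SL2Z (B1 ** B2) (U_mat h) \<and> SL2Z.ord B1 = m1 \<and> SL2Z.ord B2 = m2"
proof -
  have *: "\<exists>B1 B2. noncentral_finite_order B1 \<and> noncentral_finite_order B2 \<and>
          conjugate_SL2Z (B1 ** B2) (U_mat (t2 - t1)) \<and> trace B1 = t1 \<and> trace B2 = t2
          \<and> det B1 = 1 \<and> det B2 = 1"
    if "\<bar>t1\<bar> \<le> 1" "\<bar>t2\<bar> \<le> 1" for t1 t2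
  proof -
    \<comment> \<open>These are the normal form with \<open>a = 0\<close> and \<open>c = 1\<close>;
      their product is \<open>U_mat (t2 - t1)\<close> for all traces.\<close>
    define B1 :: "int^2^2" where "B1 = vector [vector [t1, 1], vector [-1, 0]]"
    define B2 :: "int^2^2" where "B2 = vector [vector [0, -1], vector [1, t2]]"
    have B: "trace B1 = t1" "trace B2 = t2" "det B1 = 1" "det B2 = 1"
      "B1 ** B2 = U_mat (t2 - t1)"
      by (simp_all add: B1_def B2_def mat2_simps)
    have "conjugate_SL2Z (U_mat (t2 - t1)) (U_mat (t2 - t1))"
      unfolding conjugate_SL2Z_def
      using SL2Z.inv_one by (intro bexI[of _ "\<one>\<^bsub>SL2Z\<^esub>"]) simp_all
    then show ?thesis
      using B that by (intro exI[of _ B1] exI[of _ B2]) (auto intro!: noncentral_finite_orderI)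
  qed
  \<comment> \<open>Orders 3, 4, 6 correspond to traces -1, 0, 1, and in all three types the width
    is the difference of the traces.\<close>
  have "\<exists>t1 t2. \<bar>t1\<bar> \<le> 1 \<and> \<bar>t2\<bar> \<le> 1 \<and> h = t2 - t1 \<and> (m1, t1) \<in> {(3,-1),(4,0),(6,1)}
     \<and> (m2, t2) \<in> {(3,-1),(4,0),(6,1)}"
    using assms by auto
  then obtain t1 t2 where t: "\<bar>t1\<bar> \<le> 1" "\<bar>t2\<bar> \<le> 1" "h = t2 - t1" "(m1, t1) \<in> {(3,-1),(4,0),(6,1)}"
     "(m2, t2) \<in> {(3,-1),(4,0),(6,1)}" by blast
  from *[OF t(1,2)] show ?thesis
    using t(3-) ord_of_trace by (elim ex_forward) auto
qed

section \<open>Homomorphisms out of the free product\<close>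

primrec word_eval :: "('a, 'b) monoid_scheme \<Rightarrow> (letter \<Rightarrow> 'a) \<Rightarrow> letter list \<Rightarrow> 'a" where
  "word_eval M f [] = \<one>\<^bsub>M\<^esub>"
| "word_eval M f (x # w) = f x \<otimes>\<^bsub>M\<^esub> word_eval M f w"

lemma equivclp_imp_eq:
  assumes "equivclp r x y" and "\<And>x y. r x y \<Longrightarrow> f x = f y"
  shows "f x = f y"
  using assms(1) unfolding equivclp_def
  by (induction rule: rtranclp_induct) (auto elim!: symclpE dest: assms(2))

lemma word_class_eq_iff: "word_class m1 m2 w = word_class m1 m2 w' \<longleftrightarrow> equivclp (relator_step m1 m2) w w'"
proof
  show "equivclp (relator_step m1 m2) w w'" if "word_class m1 m2 w = word_class m1 m2 w'"
  proof -
    have "w' \<in> word_class m1 m2 w'" by (simp add: word_class_def)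
    then show ?thesis unfolding that[symmetric] by (simp add: word_class_def)
  qed
  show "word_class m1 m2 w = word_class m1 m2 w'" if "equivclp (relator_step m1 m2) w w'"
    using that unfolding word_class_def by (blast intro: equivclp_trans equivclp_sym)
qed

lemma relator_step_append:
  assumes "relator_step m1 m2 w w'"
  shows "relator_step m1 m2 (u @ w @ v) (u @ w' @ v)"
  using assms
proof cases
  case (1 x y)
  then show ?thesis using relator_step.intros(1)[of m1 m2 "u @ x" "y @ v"] by simp
next
  case (2 x y)
  then show ?thesis using relator_step.intros(2)[of m1 m2 "u @ x" "y @ v"] by simp
qed

text \<open>A relator may be inserted or removed inside any surrounding word, so the two factors can
  be replaced one after the other.\<close>

lemma word_class_append_cong:
  assumes "word_class m1 m2 x = word_class m1 m2 x'" "word_class m1 m2 y = word_class m1 m2 y'"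
  shows "word_class m1 m2 (x @ y) = word_class m1 m2 (x' @ y')"
proof -
  have cong: "word_class m1 m2 (u @ w @ v) = word_class m1 m2 (u @ w' @ v)"
    if "word_class m1 m2 w = word_class m1 m2 w'" for u v w w'
    using that unfolding word_class_eq_iff[of m1 m2 w]
    by (rule equivclp_imp_eq) (auto simp: word_class_eq_iff intro: relator_step_append)
  show ?thesis
    using cong[OF assms(1), of "[]" y] cong[OF assms(2), of x' "[]"] by simp
qed

lemma carrier_cyclic_free_product [simp]:
  "carrier (cyclic_free_product m1 m2) = range (word_class m1 m2)"
  and one_cyclic_free_product [simp]: "\<one>\<^bsub>cyclic_free_product m1 m2\<^esub> = word_class m1 m2 []"
  by (simp_all add: cyclic_free_product_def)

text \<open>The product is defined as a union of classes over all representatives; these classes all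
  coincide, and the index sets are nonempty.\<close>

lemma mult_cyclic_free_product [simp]:
  "word_class m1 m2 x \<otimes>\<^bsub>cyclic_free_product m1 m2\<^esub> word_class m1 m2 y = word_class m1 m2 (x @ y)"
proof -
  have *: "word_class m1 m2 (x' @ y') = word_class m1 m2 (x @ y)"
    if "x' \<in> word_class m1 m2 x" "y' \<in> word_class m1 m2 y" for x' y'
    using that by (intro word_class_append_cong)
      (simp_all add: word_class_eq_iff, simp_all add: word_class_def equivclp_sym)
  have "x \<in> word_class m1 m2 x" "y \<in> word_class m1 m2 y" by (simp_all add: word_class_def)
  moreover have "(\<Union>x'\<in>word_class m1 m2 x. \<Union>y'\<in>word_class m1 m2 y. word_class m1 m2 (x' @ y'))
      = (\<Union>x'\<in>word_class m1 m2 x. \<Union>y'\<in>word_class m1 m2 y. word_class m1 m2 (x @ y))"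
    by (intro SUP_cong refl *)
  ultimately show ?thesis by (simp add: cyclic_free_product_def) blast
qed

lemma word_class_replicate:
  "word_class m1 m2 (replicate m1 G1) = word_class m1 m2 []"
  "word_class m1 m2 (replicate m2 G2) = word_class m1 m2 []"
  using relator_step.intros(1)[of m1 m2 "[]" "[]"] relator_step.intros(2)[of m1 m2 "[]" "[]"]
  by (auto simp: word_class_eq_iff)

context monoid
begin

lemma word_eval_closed [simp]: "range f \<subseteq> carrier G \<Longrightarrow> word_eval G f w \<in> carrier G"
  by (induction w) auto

lemma word_eval_append:
  "range f \<subseteq> carrier G \<Longrightarrow> word_eval G f (u @ v) = word_eval G f u \<otimes> word_eval G f v"
  by (induction u) (auto simp: m_assoc image_subset_iff)

lemma word_eval_replicate:
  "range f \<subseteq> carrier G \<Longrightarrow> word_eval G f (replicate n x) = f x [^] n"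
  by (induction n) (simp_all add: image_subset_iff flip: nat_pow_Suc2)

text \<open>Existence half of the universal property: the two power relations make the value of a
  word invariant under relator steps.\<close>

lemma cyclic_free_product_hom_exists:
  assumes f: "range f \<subseteq> carrier G" and ord: "f G1 [^] m1 = \<one>" "f G2 [^] m2 = \<one>"
  obtains \<phi> where "\<phi> \<in> hom (cyclic_free_product m1 m2) G"
    "\<And>w. \<phi> (word_class m1 m2 w) = word_eval G f w"
proof -
  have eval: "word_eval G f w = word_eval G f w'"
    if "equivclp (relator_step m1 m2) w w'" for w w'
    using that
  proof (rule equivclp_imp_eq)
    fix x y assume "relator_step m1 m2 x y"
    then show "word_eval G f x = word_eval G f y"
      by cases (simp_all add: word_eval_append word_eval_replicate f ord)
  qed
  \<comment> \<open>An arbitrary representative is evaluated; \<open>eval\<close> makes the choice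
    immaterial.\<close>
  define \<phi> where "\<phi> C = word_eval G f (SOME w. w \<in> C)" for C
  have \<phi>: "\<phi> (word_class m1 m2 w) = word_eval G f w" for w
  proof -
    have "w \<in> word_class m1 m2 w" by (simp add: word_class_def)
    then have "(SOME w'. w' \<in> word_class m1 m2 w) \<in> word_class m1 m2 w" by (rule someI)
    then show ?thesis unfolding \<phi>_def by (intro eval[symmetric]) (simp add: word_class_def)
  qed
  moreover have "\<phi> \<in> hom (cyclic_free_product m1 m2) G"
    by (rule homI) (auto simp: \<phi> f word_eval_append)
  ultimately show thesis by (rule that[rotated])
qed

end

text \<open>Uniqueness half of the universal property. Membership in \<open>hom\<close> does not
  assert that the unit is preserved; here the empty word maps to an idempotent, which in a group is
  the unit.\<close>

lemma (in group) hom_cyclic_free_product_eval: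
  assumes \<phi>: "\<phi> \<in> hom (cyclic_free_product m1 m2) G"
  shows "\<phi> (word_class m1 m2 w) = word_eval G (\<lambda>x. \<phi> (word_class m1 m2 [x])) w"
proof (induction w)
  case Nil
  have c: "\<phi> (word_class m1 m2 []) \<in> carrier G" using \<phi> by (auto simp: hom_def)
  have "\<phi> (word_class m1 m2 []) \<otimes> \<phi> (word_class m1 m2 []) = \<phi> (word_class m1 m2 [])"
    using hom_mult[OF \<phi>, of "word_class m1 m2 []" "word_class m1 m2 []"] by simp
  then show ?case using c by simp
next
  case (Cons x w)
  then show ?case
    using hom_mult[OF \<phi>, of "word_class m1 m2 [x]" "word_class m1 m2 w"] by simp
qed

lemma (in group) hom_cyclic_free_product_pow:
  assumes \<phi>: "\<phi> \<in> hom (cyclic_free_product m1 m2) G"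
  shows "\<phi> (word_class m1 m2 [G1]) [^] m1 = \<one>" "\<phi> (word_class m1 m2 [G2]) [^] m2 = \<one>"
proof -
  have "range (\<lambda>x. \<phi> (word_class m1 m2 [x])) \<subseteq> carrier G" using \<phi> by (auto simp: hom_def)
  note eval = word_eval_replicate[OF this] hom_cyclic_free_product_eval[OF \<phi>]
  show "\<phi> (word_class m1 m2 [G1]) [^] m1 = \<one>" "\<phi> (word_class m1 m2 [G2]) [^] m2 = \<one>"
    using eval(1)[of m1 G1] eval(1)[of m2 G2] eval(2)[of "replicate m1 G1"]
      eval(2)[of "replicate m2 G2"] eval(2)[of "[]"]
    by (simp_all add: word_class_replicate)
qed

section \<open>The Jacobi group\<close>

text \<open>The standard symplectic form, so that \<open>s * wedge d e\<close> is the pairing of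
  \<open>d\<close> and \<open>e\<close> by \<open>J_mat s\<close>.\<close>

definition wedge :: "int^2 \<Rightarrow> int^2 \<Rightarrow> int" where
  "wedge d e = d$1 * e$2 - d$2 * e$1"

lemma wedge_mulv: "wedge (B *v d) (B *v e) = det B * wedge d e" for B :: "int^2^2"
  by (simp add: wedge_def mulv2_nth det_2 algebra_simps)

lemma wedge_self [simp]: "wedge d d = 0"
  by (simp add: wedge_def)

lemma vector_4:
  "(vector [a,b,c,d] :: 'a::zero^4)$1 = a" "(vector [a,b,c,d] :: 'a^4)$2 = b"
  "(vector [a,b,c,d] :: 'a^4)$3 = c" "(vector [a,b,c,d] :: 'a^4)$4 = d"
  by (simp_all add: vector_def)

lemma T_mat_nth [simp]:
  "T_mat s B d z$1$1 = 1" "T_mat s B d z$1$2 = s * wedge d (column 1 B)"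
  "T_mat s B d z$1$3 = s * wedge d (column 2 B)" "T_mat s B d z$1$4 = z"
  "T_mat s B d z$2$1 = 0" "T_mat s B d z$2$2 = B$1$1"
  "T_mat s B d z$2$3 = B$1$2" "T_mat s B d z$2$4 = d$1"
  "T_mat s B d z$3$1 = 0" "T_mat s B d z$3$2 = B$2$1"
  "T_mat s B d z$3$3 = B$2$2" "T_mat s B d z$3$4 = d$2"
  "T_mat s B d z$4$1 = 0" "T_mat s B d z$4$2 = 0" "T_mat s B d z$4$3 = 0" "T_mat s B d z$4$4 = 1"
  by (simp_all add: T_mat_def vector_4 Let_def vector_matrix_mult_def sum_2 mult2_nth J_mat_def
      wedge_def column_def algebra_simps)

lemma T_mat_eq_iff: "T_mat s B d z = T_mat s B' d' z' \<longleftrightarrow> B = B' \<and> d = d' \<and> z = z'"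
proof
  assume T: "T_mat s B d z = T_mat s B' d' z'"
  have "T_mat s B d z$i$j = T_mat s B' d' z'$i$j" for i j by (simp only: T)
  from this[of 1 4] this[of 2 2] this[of 2 3] this[of 2 4] this[of 3 2] this[of 3 3] this[of 3 4]
  show "B = B' \<and> d = d' \<and> z = z'" by (simp add: mat2_eq_iff vec2_eq_iff)
qed simp

lemma T_mat_one: "T_mat s (mat 1) 0 0 = mat 1"
  by (simp add: vec_eq_iff forall_4 wedge_def mat_def)

text \<open>The top row of the product again has the prescribed shape because \<open>B\<close>, of
  determinant one, preserves the wedge.\<close>

lemma T_mat_mult:
  assumes "det B = 1"
  shows "T_mat s B d z ** T_mat s B' d' z'
       = T_mat s (B ** B') (d + B *v d') (z + z' + s * wedge d (B *v d'))"
proof -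
  have col: "column j (B ** B') = B *v column j B'" for j
    by (simp add: vec2_eq_iff column_def mulv2_nth mult2_nth)
  have wedge_add: "wedge (x + y) w = wedge x w + wedge y w" for x y w
    by (simp add: wedge_def algebra_simps)
  have split: "s * wedge (d + B *v d') (column j (B ** B'))
    = s * wedge d' (column j B') + s * wedge d (B *v column j B')" for j
    by (simp add: col wedge_add wedge_mulv assms algebra_simps)
  have expand: "s * wedge d (B *v x) = s * wedge d (column 1 B) * x$1 + s * wedge d (column 2 B) * x$2" for x
    by (simp add: wedge_def mulv2_nth column_def algebra_simps)
  show ?thesis
    unfolding vec_eq_iff forall_4
    by (simp add: matrix_matrix_mult_def[of "T_mat s B d z"] sum_4 split)
       (simp add: expand mult2_nth mulv2_nth column_def)
qed

lemma carrier_jacobi_group: "X \<in> carrier (jacobi_group s) \<longleftrightarrow> (\<exists>B d z. det B = 1 \<and> X = T_mat s B d z)"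
  and mult_jacobi_group [simp]: "X \<otimes>\<^bsub>jacobi_group s\<^esub> Y = X ** Y"
  and one_jacobi_group [simp]: "\<one>\<^bsub>jacobi_group s\<^esub> = mat 1"
  by (auto simp: jacobi_group_def)

lemma group_jacobi_group: "group (jacobi_group s)"
proof (rule groupI)
  fix X Y assume "X \<in> carrier (jacobi_group s)" "Y \<in> carrier (jacobi_group s)"
  then show "X \<otimes>\<^bsub>jacobi_group s\<^esub> Y \<in> carrier (jacobi_group s)"
    by (auto simp: carrier_jacobi_group T_mat_mult) (metis det_mul mult_1)
next
  show "\<one>\<^bsub>jacobi_group s\<^esub> \<in> carrier (jacobi_group s)"
    unfolding carrier_jacobi_group one_jacobi_group T_mat_one[of s, symmetric] by (metis det_I)
next
  fix X assume "X \<in> carrier (jacobi_group s)"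
  then obtain B d z where B: "det B = 1" and X: "X = T_mat s B d z"
    by (auto simp: carrier_jacobi_group)
  have "det (adj2 B) = 1" "adj2 B ** B = mat 1"
    using B by (simp_all add: mat2_simps algebra_simps)
  \<comment> \<open>The corner of the inverse is \<open>- z\<close>: the correction term is the
    wedge of two opposite vectors.\<close>
  moreover from this have "T_mat s (adj2 B) (- (adj2 B *v d)) (- z) ** X = mat 1"
    by (simp add: X T_mat_mult T_mat_one[of s, symmetric] T_mat_eq_iff) (simp add: wedge_def)
  ultimately show "\<exists>Y\<in>carrier (jacobi_group s). Y \<otimes>\<^bsub>jacobi_group s\<^esub> X = \<one>\<^bsub>jacobi_group s\<^esub>"
    unfolding mult_jacobi_group one_jacobi_group by (metis carrier_jacobi_group)
qed (simp_all add: matrix_mul_assoc)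

interpretation jacobi: group "jacobi_group s" for s
  by (rule group_jacobi_group)

text \<open>Over the rationals \<open>T\<close> is conjugate, by the translation with \<open>e / n\<close>, to \<open>T(B, 0, z0 / n\<^sup>2)\<close>.
  The two equations are this conjugation with denominators cleared.\<close>

lemma T_mat_pow:
  assumes B: "det B = 1" and e: "e - B *v e = n *s d"
  shows "\<exists>d' z'. T_mat s B d z [^]\<^bsub>jacobi_group s\<^esub> (j::nat) = T_mat s (B [^]\<^bsub>SL2Z\<^esub> j) d' z' \<and>
           n *s d' = e - (B [^]\<^bsub>SL2Z\<^esub> j) *v e \<and>
           n^2 * z' = int j * (n^2 * z + s * wedge e (B *v e)) - s * wedge e ((B [^]\<^bsub>SL2Z\<^esub> j) *v e)"
proof (induction j)
  case 0
  show ?case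
    by (intro exI[of _ 0]) (simp add: T_mat_one)
next
  case (Suc j)
  let ?A = "B [^]\<^bsub>SL2Z\<^esub> j"
  let ?z0 = "n^2 * z + s * wedge e (B *v e)"
  obtain d' z' where T: "T_mat s B d z [^]\<^bsub>jacobi_group s\<^esub> j = T_mat s ?A d' z'"
    and d': "n *s d' = e - ?A *v e" and z': "n^2 * z' = int j * ?z0 - s * wedge e (?A *v e)"
    using Suc by blast
  have A: "det ?A = 1" using SL2Z.nat_pow_closed[of B j] B by simp
  have "n *s (d' + ?A *v d) = e - (?A ** B) *v e"
  proof -
    have "n *s (d' + ?A *v d) = n *s d' + ?A *v (n *s d)"
      by (simp add: vec2_eq_iff mulv2_nth algebra_simps)
    then show ?thesis unfolding d' e[symmetric]
      by (simp add: matrix_vector_mult_diff_distrib flip: matrix_vector_mul_assoc)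
  qed
  moreover have "n^2 * (z' + z + s * wedge d' (?A *v d)) = int (Suc j) * ?z0 - s * wedge e ((?A ** B) *v e)"
  proof -
    \<comment> \<open>The factor \<open>n^2\<close> replaces \<open>d'\<close> and \<open>d\<close>
      by \<open>e - A e\<close> and \<open>e - B e\<close>, with \<open>A\<close> the current power
      of \<open>B\<close>; invariance of the wedge under \<open>A\<close> then collapses the
      expansion.\<close>
    have "n^2 * wedge d' (?A *v d) = wedge (n *s d') (?A *v (n *s d))"
      by (simp add: wedge_def mulv2_nth power2_eq_square algebra_simps)
    also have "\<dots> = wedge (e - ?A *v e) (?A *v e - ?A *v (B *v e))"
      unfolding d' e[symmetric] by (simp add: matrix_vector_mult_diff_distrib)
    also have "\<dots> = wedge e (?A *v e) - wedge e (?A *v (B *v e))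
        - wedge (?A *v e) (?A *v e) + wedge (?A *v e) (?A *v (B *v e))"
      by (simp add: wedge_def algebra_simps)
    also have "\<dots> = wedge e (?A *v e) - wedge e ((?A ** B) *v e) + wedge e (B *v e)"
      by (simp only: matrix_vector_mul_assoc[symmetric] wedge_mulv A wedge_self)
    finally have w: "n^2 * wedge d' (?A *v d)
        = wedge e (?A *v e) - wedge e ((?A ** B) *v e) + wedge e (B *v e)" .
    have "n^2 * (z' + z + s * wedge d' (?A *v d)) = n^2 * z' + n^2 * z + s * (n^2 * wedge d' (?A *v d))"
      by (simp add: algebra_simps)
    then show ?thesis unfolding z' w by (simp add: algebra_simps)
  qed
  ultimately show ?case
    by (intro exI[of _ "d' + ?A *v d"] exI[of _ "z' + z + s * wedge d' (?A *v d)"])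
       (simp add: T T_mat_mult[OF A])
qed

lemma mulv_adj2: "A *v (adj2 A *v v) = det A *s v"
  by (simp add: mat2_simps algebra_simps)

lemma det_mat1_minus: "det B = 1 \<Longrightarrow> det (mat 1 - B) = 2 - trace B" for B :: "int^2^2"
  by (simp add: det_2 trace2 algebra_simps)

text \<open>In the power formula take \<open>n = det (mat 1 - B)\<close> and \<open>e\<close> the
  adjugate of \<open>mat 1 - B\<close> applied to \<open>d\<close>. For exponent \<open>m\<close>
  the translation part vanishes, and what remains is one linear equation for
  \<open>z\<close>.\<close>

lemma T_mat_pow_eq_one_iff:
  assumes B: "det B = 1" "trace B \<noteq> 2" and m: "B [^]\<^bsub>SL2Z\<^esub> m = mat 1" "m > (0::nat)"
  shows "T_mat s B d z [^]\<^bsub>jacobi_group s\<^esub> m = mat 1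
     \<longleftrightarrow> (2 - trace B) * z = s * wedge (adj2 (mat 1 - B) *v d) d"
proof -
  define e where "e = adj2 (mat 1 - B) *v d"
  define n where "n = 2 - trace B"
  have n: "n \<noteq> 0" using B by (simp add: n_def)
  have Be: "B *v e = e - n *s d"
    using mulv_adj2[of "mat 1 - B" d] det_mat1_minus[OF B(1)]
    by (simp add: e_def n_def matrix_vector_mult_diff_rdistrib algebra_simps)
  define z0 where "z0 = n^2 * z + s * wedge e (B *v e)"
  obtain d' z' where T: "T_mat s B d z [^]\<^bsub>jacobi_group s\<^esub> m = T_mat s (mat 1) d' z'"
    and d': "n *s d' = 0" and z': "n^2 * z' = int m * z0"
  proof -
    have "e - B *v e = n *s d" by (simp add: Be)
    from T_mat_pow[OF B(1) this, of s z m] show thesis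
      unfolding m by (elim exE conjE) (rule that, simp_all add: z0_def)
  qed
  have "d' = 0" using d' n by (simp add: vec2_eq_iff)
  then have "T_mat s B d z [^]\<^bsub>jacobi_group s\<^esub> m = mat 1 \<longleftrightarrow> n^2 * z' = 0"
    using n by (simp add: T T_mat_one[of s, symmetric] T_mat_eq_iff)
  also have "\<dots> \<longleftrightarrow> z0 = 0" using m by (simp add: z')
  also have "z0 = n * (n * z - s * wedge e d)"
    unfolding z0_def Be by (simp add: wedge_def power2_eq_square algebra_simps)
  finally show ?thesis using n by (simp add: n_def e_def)
qed

section \<open>Arithmetic of a normalized pair\<close>

text \<open>Packages the conclusion of \<open>elliptic_pair_normal_form\<close>. With
  \<open>c = 1\<close> or \<open>c = -1\<close> and \<open>h = c * (t2 - t1)\<close>, the later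
  identities are polynomial in \<open>a\<close> and the traces.\<close>

locale normalized_pair =
  fixes B1 B2 :: "int^2^2" and h a c t1 t2 :: int
  assumes type: "(t1, t2, h, c) \<in>
       {(-1,0,1,1), (0,-1,1,-1), (0,1,1,1), (1,0,1,-1), (-1,1,2,1), (1,-1,2,-1)}"
    and B1: "B1$1$1 = t1 - a" "B1$1$2 = c * (1 - a * (t1 - a))" "B1$2$1 = - c" "B1$2$2 = a"
    and B2: "B2$1$1 = a" "B2$1$2 = a * h - c * (1 - a * (t1 - a))" "B2$2$1 = c" "B2$2$2 = t2 - a"
begin

lemma c_cases: "c = 1 \<or> c = -1"
  using type by auto

lemma h_eq: "h = c * (t2 - t1)"
  using type by auto

lemma h_pos: "h > 0"
  using type by auto

lemma n_pos: "2 - t1 > 0" "2 - t2 > 0"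
  using type by auto

lemma bezout: obtains x y where "(2 - t2) * x + (2 - t1) * y = 1"
proof -
  have "coprime (2 - t2) (2 - t1)" using type by auto
  then show thesis by (metis that bezout_int coprime_iff_gcd_eq_1 mult.commute)
qed

lemma det_eq: "det B1 = 1" "det B2 = 1"
  using c_cases by (auto simp: det_2 B1 B2 h_eq algebra_simps)

lemma trace_eq: "trace B1 = t1" "trace B2 = t2"
  by (simp_all add: trace2 B1 B2)

lemma product_eq: "B1 ** B2 = U_mat h"
  using c_cases by (auto simp: mat2_eq_iff mult2_nth B1 B2 h_eq algebra_simps)

text \<open>The value at \<open>g1 g2\<close> of the cocycle with values \<open>d1\<close>,
  \<open>d2\<close> on the generators; the square-zero condition is the vanishing of its second
  coordinate.\<close>

definition cusp :: "int^2 \<Rightarrow> int^2 \<Rightarrow> int^2" where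
  "cusp d1 d2 = d1 + B1 *v d2"

text \<open>On \<open>(mat 1 - B1) *v u\<close> this form equals
  \<open>- c * (2 - t1) * u$2\<close>, so it identifies the cokernel of \<open>mat 1 - B1\<close>
  with the integers modulo \<open>2 - t1\<close>. Likewise \<open>lin2\<close> equals
  \<open>c * (2 - t2) * u$2\<close> on \<open>(mat 1 - B2) *v u\<close>.\<close>

definition lin1 :: "int^2 \<Rightarrow> int" where
  "lin1 d = d$1 - c * (1 - t1 + a) * d$2"

definition lin2 :: "int^2 \<Rightarrow> int" where
  "lin2 d = d$1 + c * (1 - a) * d$2"

text \<open>The weights are crossed so that the two contributions of a coboundary cancel.\<close>

definition kappa :: "int^2 \<Rightarrow> int^2 \<Rightarrow> int" where
  "kappa d1 d2 = (2 - t2) * lin1 d1 + (2 - t1) * lin2 d2"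

lemma cusp_zero_iff: "cusp d1 d2$2 = 0 \<longleftrightarrow> d2$1 = c * (d1$2 + a * d2$2)"
  using c_cases by (auto simp: cusp_def mulv2_nth B1 algebra_simps)

lemma cusp_add: "cusp (d1 + e1) (d2 + e2) = cusp d1 d2 + cusp e1 e2"
  by (simp add: cusp_def matrix_vector_right_distrib)

lemma kappa_add: "kappa (d1 + e1) (d2 + e2) = kappa d1 d2 + kappa e1 e2"
  by (simp add: kappa_def lin1_def lin2_def algebra_simps)

lemma cusp_coboundary: "cusp ((mat 1 - B1) *v u) ((mat 1 - B2) *v u)$2 = 0"
  using c_cases by (auto simp: cusp_zero_iff mulv2_nth B1 B2 h_eq algebra_simps)

lemma kappa_coboundary: "kappa ((mat 1 - B1) *v u) ((mat 1 - B2) *v u) = 0"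
  using c_cases by (auto simp: kappa_def lin1_def lin2_def mulv2_nth B1 B2 h_eq algebra_simps)

lemma cusp_first:
  assumes "cusp d1 d2$2 = 0"
  shows "cusp d1 d2$1 = lin1 d1 + lin2 d2"
proof -
  have x2: "d2$1 = c * (d1$2 + a * d2$2)" using assms by (simp add: cusp_zero_iff)
  show ?thesis
    unfolding cusp_def lin1_def lin2_def vector_add_component mulv2_nth B1 x2
    using c_cases by (elim disjE) (simp_all add: algebra_simps)
qed

lemma kappa_zero_imp_coboundary:
  assumes K: "cusp d1 d2$2 = 0" and 0: "kappa d1 d2 = 0"
  shows "\<exists>u. d1 = (mat 1 - B1) *v u \<and> d2 = (mat 1 - B2) *v u"
proof -
  obtain x y where xy: "(2 - t2) * x + (2 - t1) * y = 1" by (rule bezout)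
  \<comment> \<open>By coprimality \<open>kappa d1 d2 = 0\<close> forces
    \<open>lin1 d1 = (2 - t1) * w\<close> and \<open>lin2 d2 = - (2 - t2) * w\<close>; the Bezout
    coefficients produce the common quotient \<open>w\<close>.\<close>
  define w where "w = y * lin1 d1 - x * lin2 d2"
  have k: "(2 - t2) * lin1 d1 = - (2 - t1) * lin2 d2"
    using 0 unfolding kappa_def by (simp only: mult_minus_left eq_neg_iff_add_eq_0)
  have "(2 - t1) * w = (2 - t1) * y * lin1 d1 + x * (- (2 - t1) * lin2 d2)"
    by (simp add: w_def algebra_simps)
  also have "\<dots> = ((2 - t2) * x + (2 - t1) * y) * lin1 d1"
    unfolding k[symmetric] by (simp add: algebra_simps)
  finally have l1: "lin1 d1 = (2 - t1) * w" using xy by simp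
  have "(2 - t2) * w = y * ((2 - t2) * lin1 d1) - (2 - t2) * x * lin2 d2"
    by (simp add: w_def algebra_simps)
  also have "\<dots> = - (((2 - t2) * x + (2 - t1) * y) * lin2 d2)"
    unfolding k by (simp add: algebra_simps)
  finally have l2: "lin2 d2 = - ((2 - t2) * w)" using xy by simp
  \<comment> \<open>The value of \<open>lin1\<close> on a coboundary dictates
    \<open>u$2 = - c * w\<close>; the first entry then solves the second coordinate of
    \<open>d1 = (mat 1 - B1) *v u\<close>.\<close>
  define u :: "int^2" where "u = vector [c * (d1$2 + (1 - a) * c * w), - c * w]"
  have x1: "d1$1 = (2 - t1) * w + c * (1 - t1 + a) * d1$2"
    using l1 by (simp add: lin1_def)
  have x2: "d2$1 = c * (d1$2 + a * d2$2)" using K by (simp add: cusp_zero_iff)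
  have y2: "d2$2 = - d1$2 - c * (2 - t2) * w"
    using l2 c_cases unfolding lin2_def x2 by (auto simp: algebra_simps)
  have "d1 = (mat 1 - B1) *v u" "d2 = (mat 1 - B2) *v u"
    using c_cases
    by (auto simp: vec2_eq_iff mulv2_nth u_def x1 x2 y2 B1 B2 h_eq algebra_simps)
  then show ?thesis by blast
qed

lemma kappa_surj: "\<exists>d1 d2. cusp d1 d2$2 = 0 \<and> kappa d1 d2 = k"
proof -
  obtain x y where xy: "(2 - t2) * x + (2 - t1) * y = 1" by (rule bezout)
  \<comment> \<open>Here \<open>lin1\<close> is \<open>k * x\<close> and \<open>lin2\<close> is
    \<open>k * y\<close>; the proportion of the entries of \<open>?d2\<close> is dictated by
    \<open>cusp_zero_iff\<close>.\<close>
  let ?d1 = "vector [k * x, 0] :: int^2" and ?d2 = "vector [a * (k * y), c * (k * y)] :: int^2"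
  have "kappa ?d1 ?d2 = k * ((2 - t2) * x + (2 - t1) * y)"
    using c_cases by (auto simp: kappa_def lin1_def lin2_def algebra_simps)
  moreover have "cusp ?d1 ?d2$2 = 0"
    using c_cases by (auto simp: cusp_zero_iff)
  ultimately show ?thesis using xy by auto
qed

text \<open>Splitting off the multiples of \<open>2 - t1\<close> turns solvability for the corner
  entry into a congruence on \<open>lin1\<close> alone.\<close>

lemma wedge_adj1:
  "wedge (adj2 (mat 1 - B1) *v d) d = c * (lin1 d)^2 + (2 - t1) * (d$2 * (lin1 d + c * d$2))"
  using c_cases
  by (auto simp: wedge_def mulv2_nth B1 lin1_def power2_eq_square algebra_simps)

lemma wedge_adj2:
  "wedge (adj2 (mat 1 - B2) *v d) d = - c * (lin2 d)^2 + (2 - t2) * (d$2 * (d$1 - c * a * d$2))"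
  using c_cases
  by (auto simp: wedge_def mulv2_nth B2 h_eq lin2_def power2_eq_square algebra_simps)

text \<open>The terms linear in \<open>cusp d1 d2\<close> cancel, and \<open>c h = (2 - t1) - (2 - t2)\<close> turns the
  remaining form in \<open>lin1\<close>, \<open>lin2\<close> into a square.\<close>

lemma minor_eq_kappa_square:
  assumes K: "cusp d1 d2$2 = 0"
    and z1: "(2 - t1) * z1 = s * wedge (adj2 (mat 1 - B1) *v d1) d1"
    and z2: "(2 - t2) * z2 = s * wedge (adj2 (mat 1 - B2) *v d2) d2"
    and z: "z = z1 + z2 + s * wedge d1 (B1 *v d2)"
    and p: "p = cusp d1 d2$1"
  shows "(2 - t1) * (2 - t2) * (s * p^2 - z * h) = s * (kappa d1 d2)^2"
proof -
  define n1 where "n1 = 2 - t1"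
  define n2 where "n2 = 2 - t2"
  define l1 where "l1 = lin1 d1"
  define l2 where "l2 = lin2 d2"
  define y1 where "y1 = d1$2"
  define y2 where "y2 = d2$2"
  have x2: "d2$1 = c * (y1 + a * y2)" using K by (simp add: cusp_zero_iff y1_def y2_def)
  have p': "p = l1 + l2" using cusp_first[OF K] p by (simp add: l1_def l2_def)
  have l2': "l2 = c * (y1 + y2)"
    unfolding l2_def lin2_def x2 y2_def[symmetric] by (simp add: algebra_simps)
  have w: "wedge d1 (B1 *v d2) = - y1 * p"
  proof -
    have "(B1 *v d2)$1 = p - d1$1" "(B1 *v d2)$2 = - y1"
      using K p by (simp_all add: cusp_def y1_def)
    then show ?thesis unfolding wedge_def y1_def[symmetric] by (simp only:) (simp add: algebra_simps)
  qed
  have z1': "n1 * z1 = s * (c * l1^2 + n1 * (y1 * (l1 + c * y1)))"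
    using z1 unfolding wedge_adj1 by (simp add: n1_def l1_def y1_def)
  have z2': "n2 * z2 = s * (- c * l2^2 + n2 * (y2 * (c * y1)))"
    using z2 unfolding wedge_adj2 x2 y2_def[symmetric] by (simp add: n2_def l2_def algebra_simps)
  have h: "h = c * (n1 - n2)" by (simp add: h_eq n1_def n2_def)
  have "n1 * n2 * z = n2 * (n1 * z1) + n1 * (n2 * z2) - n1 * n2 * s * y1 * p"
    unfolding z w by (simp add: algebra_simps)
  also have "\<dots> = s * c * (n2 * l1^2 - n1 * l2^2) + n1 * n2 * s * y1 * (l1 + c * (y1 + y2) - p)"
    unfolding z1' z2' by (simp add: algebra_simps)
  also have "\<dots> = s * c * (n2 * l1^2 - n1 * l2^2)" unfolding p' l2'[symmetric] by simp
  finally have z': "n1 * n2 * z = s * c * (n2 * l1^2 - n1 * l2^2)" .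
  have "n1 * n2 * (s * p^2 - z * h) = n1 * n2 * s * p^2 - (n1 * n2 * z) * h"
    by (simp add: algebra_simps)
  also have "\<dots> = n1 * n2 * s * p^2 - s * c * (n2 * l1^2 - n1 * l2^2) * h" unfolding z' ..
  also have "\<dots> = s * (n2 * l1 + n1 * l2)^2"
    using c_cases unfolding h p' by (auto simp: power2_eq_square algebra_simps)
  finally show ?thesis by (simp add: n1_def n2_def l1_def l2_def kappa_def)
qed

text \<open>Necessity is the minor identity. Conversely, modulo \<open>2 - t1\<close> the form
  \<open>kappa\<close> is \<open>(2 - t2) * lin1\<close> with invertible factor, so
  \<open>2 - t1\<close> divides \<open>s * lin1^2\<close>, which is solvability of the first
  equation; the second is symmetric.\<close>

lemma exists_heights_iff:
  assumes K: "cusp d1 d2$2 = 0"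
  shows "(\<exists>z1 z2. (2 - t1) * z1 = s * wedge (adj2 (mat 1 - B1) *v d1) d1 \<and>
                  (2 - t2) * z2 = s * wedge (adj2 (mat 1 - B2) *v d2) d2)
     \<longleftrightarrow> (2 - t1) * (2 - t2) dvd s * (kappa d1 d2)^2" (is "?L \<longleftrightarrow> ?R")
proof
  assume ?L
  then show ?R using minor_eq_kappa_square[OF K _ _ refl refl] by (metis dvd_triv_left)
next
  assume R: ?R
  define n1 where "n1 = 2 - t1"
  define n2 where "n2 = 2 - t2"
  have cop: "coprime n1 n2" using type by (auto simp: n1_def n2_def)
  have "n1 dvd s * (n2 * lin1 d1 + n1 * lin2 d2)^2" "n2 dvd s * (n2 * lin1 d1 + n1 * lin2 d2)^2"
    using R dvd_mult_left dvd_mult_right unfolding kappa_def n1_def[symmetric] n2_def[symmetric] by blast+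
  moreover have "s * (n2 * lin1 d1 + n1 * lin2 d2)^2
     = (s * (lin1 d1)^2) * n2^2 + n1 * (s * (2 * n2 * lin1 d1 * lin2 d2 + n1 * (lin2 d2)^2))"
     (is "?k = ?x + n1 * ?y")
    by (simp add: power2_eq_square algebra_simps)
  moreover have "?k = (s * (lin2 d2)^2) * n1^2 + n2 * (s * (2 * n1 * lin1 d1 * lin2 d2 + n2 * (lin1 d1)^2))"
     (is "?k = ?x' + n2 * ?y'")
    by (simp add: power2_eq_square algebra_simps)
  ultimately have "n1 dvd ?x + n1 * ?y" "n2 dvd ?x' + n2 * ?y'" by metis+
  then have "n1 dvd ?x" "n2 dvd ?x'" by (simp_all add: dvd_add_left_iff)
  then have "n1 dvd s * (lin1 d1)^2" "n2 dvd s * (lin2 d2)^2"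
    using cop by (simp_all add: coprime_dvd_mult_left_iff coprime_commute)
  then have "n1 dvd s * wedge (adj2 (mat 1 - B1) *v d1) d1" "n2 dvd s * wedge (adj2 (mat 1 - B2) *v d2) d2"
    unfolding wedge_adj1 wedge_adj2 n1_def[symmetric] n2_def[symmetric]
    by (simp_all add: distrib_left right_diff_distrib mult.left_commute[of s] dvd_add_left_iff)
  then show ?L unfolding n1_def n2_def dvd_def by metis
qed

end

section \<open>The cusp monodromy\<close>

text \<open>Counts cosets by the values of a complete invariant. The invariant is a mere function,
  because the one used below is a pair of remainders.\<close>

lemma (in group) bij_betw_fibres_rcosets:
  assumes H: "subgroup H G" and T: "f ` carrier G = T"
    and f: "\<And>x y. x \<in> carrier G \<Longrightarrow> y \<in> carrier G \<Longrightarrow> f x = f y \<longleftrightarrow> x \<otimes> inv y \<in> H"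
  shows "bij_betw (\<lambda>t. {x \<in> carrier G. f x = t}) T (rcosets H)"
proof -
  have coset: "H #> y = {x \<in> carrier G. f x = f y}" if "y \<in> carrier G" for y
    using subgroup.rcos_module[OF H group_axioms that] f[OF _ that]
      r_coset_subset_G[OF subgroup.subset[OF H] that] by blast
  have "(\<lambda>t. {x \<in> carrier G. f x = t}) ` T = rcosets H"
    unfolding RCOSETS_def T[symmetric] by (auto simp: coset)
  moreover have "inj_on (\<lambda>t. {x \<in> carrier G. f x = t}) T"
    unfolding T[symmetric] by (rule inj_onI) blast
  ultimately show ?thesis by (simp add: bij_betw_def)
qed

text \<open>The shape of the logarithm at a square-zero cusp: it factors through the last two
  coordinates and lands in the plane of the first two.\<close>

definition cusp_block :: "rat \<Rightarrow> rat \<Rightarrow> rat \<Rightarrow> rat \<Rightarrow> rat^4^4" where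
  "cusp_block q z h p = vector [vector [0,0,q,z], vector [0,0,h,p], 0, 0]"

lemma cusp_block_mulv:
  "cusp_block q z h p *v v = vector [q * v$3 + z * v$4, h * v$3 + p * v$4, 0, 0]"
  by (simp add: vec_eq_iff forall_4 matrix_vector_mult_def sum_4 cusp_block_def vector_4)

text \<open>Row rank: the second row is nonzero as \<open>h\<close> is, and the first is a multiple
  of it exactly when the minor vanishes.\<close>

lemma rank_cusp_block:
  assumes h: "h \<noteq> 0"
  shows "rank (cusp_block q z h p) = (if q * p = z * h then 1 else 2)"
proof -
  let ?r1 = "vector [0,0,q,z] :: rat^4" and ?r2 = "vector [0,0,h,p] :: rat^4"
  have "rows (cusp_block q z h p) = {?r1, ?r2, 0}"
  proof -
    have "(UNIV :: 4 set) = {1, 2, 3, 4}" using exhaust_4 by blast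
    then have "rows (cusp_block q z h p) = (\<lambda>i. cusp_block q z h p$i) ` {1,2,3,4}"
      by (simp add: rows_def row_def full_SetCompr_eq)
    then show ?thesis by (simp add: cusp_block_def vector_4)
  qed
  then have "rank (cusp_block q z h p) = vec.dim (insert 0 (insert ?r1 {?r2}))"
    by (simp add: row_rank_def_gen insert_commute)
  also have "\<dots> = vec.dim (insert ?r1 {?r2})"
    by (simp add: vec.dim_insert vec.span_zero)
  also have "\<dots> = (if ?r1 \<in> vec.span {?r2} then 1 else 2)"
  proof -
    have "?r2 \<noteq> 0" using h by (auto simp: vec_eq_iff forall_4 vector_4)
    then have "vec.dim {?r2} = 1" by (simp add: vec.dim_insert[of _ "{}", simplified])
    then show ?thesis by (simp add: vec.dim_insert)
  qed
  also have "?r1 \<in> vec.span {?r2} \<longleftrightarrow> q * p = z * h"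
  proof
    assume "?r1 \<in> vec.span {?r2}"
    then obtain k where "?r1 = k *s ?r2" by (auto simp: vec.span_singleton)
    then have "q = k * h" "z = k * p" by (auto simp: vec_eq_iff forall_4 vector_4)
    then show "q * p = z * h" by simp
  next
    assume "q * p = z * h"
    then have "?r1 = (q / h) *s ?r2" using h by (simp add: vec_eq_iff forall_4 vector_4 field_simps)
    then show "?r1 \<in> vec.span {?r2}" by (auto simp: vec.span_singleton)
  qed
  finally show ?thesis .
qed

lemma group_additive_group_on:
  assumes "0 \<in> L" "\<And>x y. x \<in> L \<Longrightarrow> y \<in> L \<Longrightarrow> x + y \<in> L" "\<And>x. x \<in> L \<Longrightarrow> - x \<in> L"
  shows "group (additive_group_on L)"
    and "x \<in> L \<Longrightarrow> inv\<^bsub>additive_group_on L\<^esub> x = - x"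
proof -
  show g: "group (additive_group_on L)"
    unfolding additive_group_on_def
  proof (rule groupI, goal_cases)
    case (5 x)
    then show ?case using assms(3)[of x] by (auto intro: bexI[of _ "- x"])
  qed (simp_all add: assms add.assoc)
  show "inv\<^bsub>additive_group_on L\<^esub> x = - x" if "x \<in> L"
    by (rule group.inv_equality[OF g]) (use assms that in \<open>auto simp: additive_group_on_def\<close>)
qed

section \<open>The image lattice and its saturation inside a coordinate plane\<close>

definition embed_plane :: "int \<Rightarrow> int \<Rightarrow> rat^4" where
  "embed_plane x y = vector [of_int x, of_int y, 0, 0]"

lemma embed_plane_nth [simp]:
  "embed_plane x y$1 = of_int x" "embed_plane x y$2 = of_int y"
  "embed_plane x y$3 = 0" "embed_plane x y$4 = 0"
  by (simp_all add: embed_plane_def vector_4)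

lemma embed_plane_eq_iff: "embed_plane x y = embed_plane x' y' \<longleftrightarrow> x = x' \<and> y = y'"
  by (auto simp: vec_eq_iff forall_4)

lemma embed_plane_arith:
  "embed_plane x y + embed_plane x' y' = embed_plane (x + x') (y + y')"
  "- embed_plane x y = embed_plane (- x) (- y)" "0 = embed_plane 0 0"
  by (auto simp: vec_eq_iff forall_4)

lemma image_lattice_cusp_block:
  "image_lattice (cusp_block (of_int q) (of_int z) (of_int h) (of_int p))
     = {embed_plane (q * m + z * n) (h * m + p * n) | m n. True}" (is "?L = ?R")
proof
  show "?L \<subseteq> ?R"
  proof
    fix w assume "w \<in> ?L"
    then obtain v where v: "v \<in> V_lattice" "w = cusp_block (of_int q) (of_int z) (of_int h) (of_int p) *v v"
      by (auto simp: image_lattice_def)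
    then obtain m n where "v$3 = of_int m" "v$4 = of_int n"
      by (metis (mono_tags, lifting) Ints_cases V_lattice_def mem_Collect_eq)
    then show "w \<in> ?R"
      by (auto simp: v cusp_block_mulv embed_plane_def)
  qed
  show "?R \<subseteq> ?L"
  proof
    fix w assume "w \<in> ?R"
    then obtain m n where w: "w = embed_plane (q * m + z * n) (h * m + p * n)" by blast
    let ?v = "vector [0, 0, of_int m, of_int n] :: rat^4"
    have "?v \<in> V_lattice" by (simp add: V_lattice_def forall_4 vector_4)
    moreover have "w = cusp_block (of_int q) (of_int z) (of_int h) (of_int p) *v ?v"
      by (simp add: w cusp_block_mulv vector_4 embed_plane_def)
    ultimately show "w \<in> ?L" by (auto simp: image_lattice_def)
  qed
qed

text \<open>With nonzero minor the rational image is the whole plane, by Cramer's rule, so the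
  saturation consists of all its integer points.\<close>

lemma saturated_image_lattice_cusp_block:
  assumes D: "q * p \<noteq> z * h"
  shows "saturated_image_lattice (cusp_block q z h p) = {embed_plane x y | x y. True}" (is "?L = ?R")
proof
  show "?L \<subseteq> ?R"
  proof
    fix w assume "w \<in> ?L"
    then obtain v where v: "w \<in> V_lattice" "w = cusp_block q z h p *v v"
      by (auto simp: saturated_image_lattice_def)
    then obtain x y where "w$1 = of_int x" "w$2 = of_int y"
      by (metis (mono_tags, lifting) Ints_cases V_lattice_def mem_Collect_eq)
    moreover have "w$3 = 0" "w$4 = 0" unfolding v(2) cusp_block_mulv by (simp_all add: vector_4)
    ultimately have "w = embed_plane x y" by (simp add: vec_eq_iff forall_4)
    then show "w \<in> ?R" by blast
  qed
  show "?R \<subseteq> ?L"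
  proof
    fix w assume "w \<in> ?R"
    then obtain x y where w: "w = embed_plane x y" by blast
    define D where "D = q * p - z * h"
    have "D \<noteq> 0" using D by (simp add: D_def)
    let ?X = "of_int x :: rat" and ?Y = "of_int y :: rat"
    let ?v = "vector [0, 0, (p * ?X - z * ?Y) / D, (q * ?Y - h * ?X) / D] :: rat^4"
    have "q * ((p * ?X - z * ?Y) / D) + z * ((q * ?Y - h * ?X) / D) = (D * ?X) / D"
      "h * ((p * ?X - z * ?Y) / D) + p * ((q * ?Y - h * ?X) / D) = (D * ?Y) / D"
      unfolding times_divide_eq_right add_divide_distrib[symmetric]
      by (simp_all add: D_def algebra_simps)
    then have "w = cusp_block q z h p *v ?v"
      using \<open>D \<noteq> 0\<close> by (simp add: w cusp_block_mulv vector_4 embed_plane_def)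
    moreover have "w \<in> V_lattice" by (simp add: w V_lattice_def forall_4)
    ultimately show "w \<in> ?L" by (auto simp: saturated_image_lattice_def)
  qed
qed

text \<open>With \<open>g = gcd h p = \<alpha> h + \<beta> p\<close>, the lattice spanned by \<open>(q, h)\<close> and \<open>(z, p)\<close> has the
  Hermite basis \<open>(\<alpha> q + \<beta> z, g)\<close>, \<open>((q p - z h) / g, 0)\<close>.\<close>

lemma plane_lattice_mem_iff:
  fixes q z h p :: int
  assumes g: "g = \<alpha> * h + \<beta> * p" "h = g * h'" "p = g * p'" "g > 0"
  shows "(\<exists>m n. X = q * m + z * n \<and> Y = h * m + p * n) \<longleftrightarrow>
         (\<exists>t r. Y = g * t \<and> X = (\<alpha> * q + \<beta> * z) * t + (q * p' - z * h') * r)"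
proof -
  have "g * (\<alpha> * h' + \<beta> * p') = g * 1" using g(1) unfolding g(2,3) by (simp add: algebra_simps)
  then have 1: "\<alpha> * h' + \<beta> * p' = 1" using g(4) by simp
  show ?thesis
  proof safe
    fix m n
    have "q * m + z * n = q * m * (\<alpha> * h' + \<beta> * p') + z * n * (\<alpha> * h' + \<beta> * p')"
      unfolding 1 by simp
    also have "\<dots> = (\<alpha> * q + \<beta> * z) * (h' * m + p' * n) + (q * p' - z * h') * (\<beta> * m - \<alpha> * n)"
      by (simp add: algebra_simps)
    finally show "\<exists>t r. h * m + p * n = g * t \<and> q * m + z * n = (\<alpha> * q + \<beta> * z) * t + (q * p' - z * h') * r"
      unfolding g(2,3)
      by (intro exI[of _ "h' * m + p' * n"] exI[of _ "\<beta> * m - \<alpha> * n"]) (simp add: algebra_simps)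
  next
    fix t r
    have "g * t = h * (\<alpha> * t + p' * r) + p * (\<beta> * t - h' * r)"
    proof -
      have "h * (\<alpha> * t + p' * r) + p * (\<beta> * t - h' * r) = (\<alpha> * h + \<beta> * p) * t + (h * p' - p * h') * r"
        by (simp add: algebra_simps)
      also have "h * p' - p * h' = 0" by (simp add: g(2,3))
      finally show ?thesis using g(1) by simp
    qed
    then show "\<exists>m n. (\<alpha> * q + \<beta> * z) * t + (q * p' - z * h') * r = q * m + z * n \<and> g * t = h * m + p * n"
      by (intro exI[of _ "\<alpha> * t + p' * r"] exI[of _ "\<beta> * t - h' * r"]) (simp add: algebra_simps)
  qed
qed

text \<open>Reduction modulo the Hermite basis \<open>(e, g)\<close>, \<open>(k, 0)\<close> leaves
  remainders in a box with \<open>g * |k|\<close> points, and \<open>g * k\<close> is the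
  minor.\<close>

lemma index_cusp_block:
  fixes q z h p :: int
  assumes D: "q * p \<noteq> z * h"
  defines "N \<equiv> cusp_block (of_int q) (of_int z) (of_int h) (of_int p)"
  shows "has_finite_index (image_lattice N) (additive_group_on (saturated_image_lattice N))
           (nat \<bar>q * p - z * h\<bar>)"
proof -
  let ?\<Lambda> = "{embed_plane (q * m + z * n) (h * m + p * n) | m n. True}"
  let ?S = "{embed_plane x y | x y. True}"
  let ?G = "additive_group_on ?S"
  have D': "(of_int q :: rat) * of_int p \<noteq> of_int z * of_int h"
    using D by (metis of_int_eq_iff of_int_mult)
  have S: "0 \<in> ?S" "\<And>x y. x \<in> ?S \<Longrightarrow> y \<in> ?S \<Longrightarrow> x + y \<in> ?S" "\<And>x. x \<in> ?S \<Longrightarrow> - x \<in> ?S"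
    using embed_plane_arith by fastforce+
  have grp: "Group.group ?G" by (rule group_additive_group_on(1)) (fact S)+
  have inv: "inv\<^bsub>?G\<^esub> x = - x" if "x \<in> ?S" for x
    by (rule group_additive_group_on(2)[OF _ _ _ that]) (fact S)+
  have carrier: "carrier ?G = ?S" by (simp add: additive_group_on_def)
  have sub: "subgroup ?\<Lambda> ?G"
  proof (rule group.subgroupI[OF grp])
    show "?\<Lambda> \<subseteq> carrier ?G" unfolding carrier by blast
    show "?\<Lambda> \<noteq> {}" by blast
    show "inv\<^bsub>?G\<^esub> x \<in> ?\<Lambda>" if x: "x \<in> ?\<Lambda>" for x
    proof -
      obtain m n where "x = embed_plane (q * m + z * n) (h * m + p * n)" using x by blast
      then have "inv\<^bsub>?G\<^esub> x = embed_plane (q * (-m) + z * (-n)) (h * (-m) + p * (-n))"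
        by (subst inv) (auto simp: embed_plane_arith)
      then show ?thesis by blast
    qed
    show "x \<otimes>\<^bsub>?G\<^esub> y \<in> ?\<Lambda>" if xy: "x \<in> ?\<Lambda>" "y \<in> ?\<Lambda>" for x y
    proof -
      obtain m n m' n' where "x = embed_plane (q * m + z * n) (h * m + p * n)"
        "y = embed_plane (q * m' + z * n') (h * m' + p * n')" using xy by blast
      then have "x \<otimes>\<^bsub>?G\<^esub> y = embed_plane (q * (m + m') + z * (n + n')) (h * (m + m') + p * (n + n'))"
        by (simp add: additive_group_on_def embed_plane_arith algebra_simps)
      then show ?thesis by blast
    qed
  qed
  define g where "g = gcd h p"
  obtain h' p' where hp: "h = g * h'" "p = g * p'" by (metis dvdE g_def gcd_dvd1 gcd_dvd2)
  obtain \<alpha> \<beta> where ab: "g = \<alpha> * h + \<beta> * p" using bezout_int[of h p] unfolding g_def by metis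
  have g: "g > 0" using D by (auto simp: g_def gcd_pos_int)
  define e where "e = \<alpha> * q + \<beta> * z"
  define k where "k = q * p' - z * h'"
  have gk: "q * p - z * h = g * k" unfolding hp k_def by (simp add: algebra_simps)
  then have k: "k \<noteq> 0" using D by auto
  \<comment> \<open>The floors recover the integer coordinates. Subtracting \<open>y div g\<close>
    copies of \<open>(e, g)\<close> reduces \<open>y\<close>, after which the first coordinate is
    reduced modulo \<open>|k|\<close>.\<close>
  define f :: "rat^4 \<Rightarrow> int \<times> int" where
    "f v = (let x = \<lfloor>v$1\<rfloor>; y = \<lfloor>v$2\<rfloor> in (y mod g, (x - e * (y div g)) mod \<bar>k\<bar>))" for v
  have f: "f (embed_plane x y) = (y mod g, (x - e * (y div g)) mod \<bar>k\<bar>)" for x y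
    by (simp add: f_def)
  let ?T = "{0..<g} \<times> {0..<\<bar>k\<bar>}"
  have mem: "embed_plane X Y \<in> ?\<Lambda> \<longleftrightarrow> (\<exists>t r. Y = g * t \<and> X = e * t + k * r)" for X Y
    using plane_lattice_mem_iff[OF ab hp g, of X q z Y]
    by (auto simp: embed_plane_eq_iff e_def k_def)
  have key: "f (embed_plane x y) = f (embed_plane x' y') \<longleftrightarrow> embed_plane (x - x') (y - y') \<in> ?\<Lambda>" for x y x' y'
  proof
    assume "f (embed_plane x y) = f (embed_plane x' y')"
    then have 1: "y mod g = y' mod g" and 2: "(x - e * (y div g)) mod \<bar>k\<bar> = (x' - e * (y' div g)) mod \<bar>k\<bar>"
      by (simp_all add: f)
    define t where "t = y div g - y' div g"
    have "y - y' = g * t"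
      unfolding t_def right_diff_distrib
      using 1 mult_div_mod_eq[of g y] mult_div_mod_eq[of g y'] by linarith
    moreover have "k dvd (x - e * (y div g)) - (x' - e * (y' div g))"
      using 2 by (simp add: mod_eq_dvd_iff)
    then obtain r where "(x - e * (y div g)) - (x' - e * (y' div g)) = k * r" by blast
    then have "x - x' = e * t + k * r" by (simp add: t_def algebra_simps)
    ultimately show "embed_plane (x - x') (y - y') \<in> ?\<Lambda>" unfolding mem by blast
  next
    assume "embed_plane (x - x') (y - y') \<in> ?\<Lambda>"
    then obtain t r where tr: "y - y' = g * t" "x - x' = e * t + k * r" unfolding mem by blast
    then have y: "y = y' + t * g" by (simp add: algebra_simps)
    have "y mod g = y' mod g" "y div g = y' div g + t" unfolding y using g by simp_all
    moreover from this have "(x - e * (y div g)) - (x' - e * (y' div g)) = k * r"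
      using tr(2) by (simp add: algebra_simps)
    then have "(x - e * (y div g)) mod \<bar>k\<bar> = (x' - e * (y' div g)) mod \<bar>k\<bar>"
      by (simp add: mod_eq_dvd_iff)
    ultimately show "f (embed_plane x y) = f (embed_plane x' y')" by (simp add: f)
  qed
  have "f ` carrier ?G = ?T"
  proof
    show "f ` carrier ?G \<subseteq> ?T" unfolding carrier using g k by (auto simp: f)
    show "?T \<subseteq> f ` carrier ?G"
    proof
      fix ij assume "ij \<in> ?T"
      then obtain i j where ij: "ij = (i, j)" "0 \<le> i" "i < g" "0 \<le> j" "j < \<bar>k\<bar>" by auto
      then have "f (embed_plane j i) = ij" by (simp add: f)
      then show "ij \<in> f ` carrier ?G" unfolding carrier by blast
    qed
  qed
  from this have "bij_betw (\<lambda>t. {x \<in> carrier ?G. f x = t}) ?T (rcosets\<^bsub>?G\<^esub> ?\<Lambda>)"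
  proof (rule group.bij_betw_fibres_rcosets[OF grp sub], goal_cases)
    case (1 v w)
    then obtain x y x' y' where vw: "v = embed_plane x y" "w = embed_plane x' y'"
      unfolding carrier by blast
    have "v \<otimes>\<^bsub>?G\<^esub> inv\<^bsub>?G\<^esub> w = v + - w"
      by (subst inv) (auto simp: vw additive_group_on_def)
    also have "\<dots> = embed_plane (x - x') (y - y')" by (simp add: vw embed_plane_arith)
    finally have "v \<otimes>\<^bsub>?G\<^esub> inv\<^bsub>?G\<^esub> w = embed_plane (x - x') (y - y')" .
    then show "f v = f w \<longleftrightarrow> v \<otimes>\<^bsub>?G\<^esub> inv\<^bsub>?G\<^esub> w \<in> ?\<Lambda>" using key vw by simp
  qed
  from bij_betw_finite[OF this] bij_betw_same_card[OF this]
  have "finite (rcosets\<^bsub>?G\<^esub> ?\<Lambda>)" "card (rcosets\<^bsub>?G\<^esub> ?\<Lambda>) = card ?T"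
    by simp_all
  moreover have "card ?T = nat \<bar>q * p - z * h\<bar>"
    using g by (simp add: gk abs_mult nat_mult_distrib)
  ultimately show ?thesis
    unfolding has_finite_index_def N_def image_lattice_cusp_block saturated_image_lattice_cusp_block[OF D']
    using sub by simp
qed

lemma mult_nth4: "(A ** B)$i$j = A$i$1 * B$1$j + A$i$2 * B$2$j + A$i$3 * B$3$j + A$i$4 * B$4$j"
  for A B :: "'a::semiring_1^4^4"
  by (simp add: matrix_matrix_mult_def sum_4)

lemma map_matrix_nth: "map_matrix f A$i$j = f (A$i$j)"
  by (simp add: map_matrix_def)

lemma mat_nth4: "(mat 1 :: 'a::zero_neq_one^4^4)$i$j = (if i = j then 1 else 0)"
  by (simp add: mat_def)

text \<open>When \<open>v$2 = 0\<close> the matrix \<open>P - 1\<close> already squares to zero, so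
  the logarithm is \<open>P - 1\<close>.\<close>

lemma unipotent_log_T_mat_U:
  assumes "v$2 = 0"
  shows "unipotent_log (T_mat s (U_mat h) v z)
       = cusp_block (of_int (s * v$1)) (of_int z) (of_int h) (of_int (v$1))"
  by (simp add: vec_eq_iff forall_4 unipotent_log_def Let_def mult_nth4 map_matrix_nth mat_nth4
      cusp_block_def vector_4 assms wedge_def column_def)

lemma unipotent_log_T_mat_U_square:
  fixes s h z :: int and v :: "int^2"
  assumes "s \<noteq> 0" "h \<noteq> 0"
  defines "N \<equiv> unipotent_log (T_mat s (U_mat h) v z)"
  shows "N ** N = 0 \<longleftrightarrow> v$2 = 0"
proof
  assume "v$2 = 0"
  then show "N ** N = 0"
    by (simp add: N_def unipotent_log_T_mat_U vec_eq_iff forall_4 mult_nth4 cusp_block_def vector_4)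
next
  assume N: "N ** N = 0"
  \<comment> \<open>The quadratic and cubic terms of the logarithm do not reach this entry, and it
    is free of \<open>z\<close>; thus the condition cannot depend on the corners.\<close>
  have "(N ** N)$1$3 = of_int (- s * v$2 * h)"
    by (simp add: N_def unipotent_log_def Let_def mult_nth4 map_matrix_nth mat_nth4 wedge_def column_def)
  then show "v$2 = 0" using N assms(1,2) by simp
qed

section \<open>Cocycles on the free product\<close>

lemma monoid_cyclic_free_product: "monoid (cyclic_free_product m1 m2)"
  by (rule monoidI) auto

lemma carrier_cocycle_group:
  "d \<in> carrier (cocycle_group G \<rho>) \<longleftrightarrow> d \<in> extensional (carrier G) \<and>
     (\<forall>x\<in>carrier G. \<forall>y\<in>carrier G. d (x \<otimes>\<^bsub>G\<^esub> y) = d x + \<rho> x *v d y)"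
  and mult_cocycle_group: "d \<otimes>\<^bsub>cocycle_group G \<rho>\<^esub> e = (\<lambda>x\<in>carrier G. d x + e x)"
  and one_cocycle_group: "\<one>\<^bsub>cocycle_group G \<rho>\<^esub> = (\<lambda>x\<in>carrier G. 0)"
  by (simp_all add: cocycle_group_def)

lemma comm_group_cocycle_group:
  assumes "monoid G"
  shows "comm_group (cocycle_group G \<rho>)"
proof -
  interpret monoid G by fact
  show ?thesis
  proof (rule comm_groupI, goal_cases)
    case (1 d e)
    then show ?case
      by (simp add: carrier_cocycle_group mult_cocycle_group matrix_vector_right_distrib)
  next
    case 2
    then show ?case by (simp add: carrier_cocycle_group one_cocycle_group)
  next
    case (3 d e f)
    then show ?case by (simp add: mult_cocycle_group add.assoc fun_eq_iff restrict_def)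
  next
    case (4 d e)
    then show ?case by (simp add: mult_cocycle_group add.commute)
  next
    case (5 d)
    then show ?case
      by (auto simp: carrier_cocycle_group mult_cocycle_group one_cocycle_group fun_eq_iff
          restrict_def extensional_def)
  next
    case (6 d)
    have "(\<lambda>x\<in>carrier G. - d x) \<in> carrier (cocycle_group G \<rho>)"
      using 6 by (simp add: carrier_cocycle_group vec2_eq_iff mulv2_nth)
    moreover have "(\<lambda>x\<in>carrier G. - d x) \<otimes>\<^bsub>cocycle_group G \<rho>\<^esub> d = \<one>\<^bsub>cocycle_group G \<rho>\<^esub>"
      by (simp add: mult_cocycle_group one_cocycle_group fun_eq_iff restrict_def)
    ultimately show ?case by blast
  qed
qed

lemma coboundary_in_cocycle_group:
  assumes "monoid G" and \<rho>: "\<rho> \<in> hom G SL2Z"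
  shows "(\<lambda>x\<in>carrier G. (mat 1 - \<rho> x) *v u) \<in> carrier (cocycle_group G \<rho>)"
proof -
  interpret monoid G by fact
  show ?thesis
    using hom_mult[OF \<rho>]
    by (simp add: carrier_cocycle_group matrix_vector_mult_diff_rdistrib
        matrix_vector_mult_diff_distrib matrix_vector_mul_assoc)
qed

lemma cocycle_append:
  assumes "d \<in> carrier (cocycle_group (cyclic_free_product m1 m2) \<rho>)"
  shows "d (word_class m1 m2 (u @ w))
       = d (word_class m1 m2 u) + \<rho> (word_class m1 m2 u) *v d (word_class m1 m2 w)"
  using assms by (simp add: carrier_cocycle_group)

text \<open>The cocycle rule peels letters off a word, and at the empty word a cocycle vanishes
  because \<open>\<rho>\<close> is the identity there.\<close>

lemma cocycle_eqI:
  assumes \<rho>: "\<rho> \<in> hom (cyclic_free_product m1 m2) SL2Z"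
    and d: "d \<in> carrier (cocycle_group (cyclic_free_product m1 m2) \<rho>)"
    and e: "e \<in> carrier (cocycle_group (cyclic_free_product m1 m2) \<rho>)"
    and gen: "d (word_class m1 m2 [G1]) = e (word_class m1 m2 [G1])"
      "d (word_class m1 m2 [G2]) = e (word_class m1 m2 [G2])"
  shows "d = e"
proof (rule extensionalityI)
  show "d \<in> extensional (carrier (cyclic_free_product m1 m2))"
    "e \<in> extensional (carrier (cyclic_free_product m1 m2))"
    using d e by (simp_all only: carrier_cocycle_group)
  have one: "\<rho> (word_class m1 m2 []) = mat 1"
    using SL2Z.hom_cyclic_free_product_eval[OF \<rho>, of "[]"] by simp
  have zero: "f (word_class m1 m2 []) = 0"
    if f: "f \<in> carrier (cocycle_group (cyclic_free_product m1 m2) \<rho>)" for f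
  proof -
    show ?thesis using cocycle_append[OF f, of "[]" "[]"] one by simp
  qed
  have letter: "d (word_class m1 m2 [x]) = e (word_class m1 m2 [x])" for x
    using gen by (cases x) simp_all
  have "d (word_class m1 m2 w) = e (word_class m1 m2 w)" for w
  proof (induction w)
    case Nil
    then show ?case using zero[OF d] zero[OF e] by simp
  next
    case (Cons x w)
    then show ?case using cocycle_append[OF d, of "[x]" w] cocycle_append[OF e, of "[x]" w] letter by simp
  qed
  then show "d x = e x" if "x \<in> carrier (cyclic_free_product m1 m2)" for x using that by auto
qed

text \<open>A homomorphism to the Jacobi group of scale zero is a representation together with a
  cocycle and a central character; a choice of translation parts on generators of finite
  order always extends.\<close>

lemma cocycle_exists:
  assumes \<rho>: "\<rho> \<in> hom (cyclic_free_product m1 m2) SL2Z"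
    and m: "m1 > 0" "m2 > 0"
    and t: "trace (\<rho> (word_class m1 m2 [G1])) \<noteq> 2" "trace (\<rho> (word_class m1 m2 [G2])) \<noteq> 2"
  shows "\<exists>d\<in>carrier (cocycle_group (cyclic_free_product m1 m2) \<rho>).
           d (word_class m1 m2 [G1]) = d1 \<and> d (word_class m1 m2 [G2]) = d2"
proof -
  let ?\<Gamma> = "cyclic_free_product m1 m2" and ?w = "word_class m1 m2"
  define f where "f = case_letter (T_mat 0 (\<rho> (?w [G1])) d1 0) (T_mat 0 (\<rho> (?w [G2])) d2 0)"
  have det: "det (\<rho> (?w w)) = 1" for w using \<rho> by (auto simp: hom_def)
  have "f x \<in> carrier (jacobi_group 0)" for x
    unfolding carrier_jacobi_group f_def using det by (cases x) auto
  then have "range f \<subseteq> carrier (jacobi_group 0)" by blast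
  \<comment> \<open>At scale zero the equation for the corner has right-hand side 0, so corner 0
    satisfies it for any translation part.\<close>
  moreover have "f G1 [^]\<^bsub>jacobi_group 0\<^esub> m1 = \<one>\<^bsub>jacobi_group 0\<^esub>"
    "f G2 [^]\<^bsub>jacobi_group 0\<^esub> m2 = \<one>\<^bsub>jacobi_group 0\<^esub>"
    using SL2Z.hom_cyclic_free_product_pow[OF \<rho>] T_mat_pow_eq_one_iff[OF det] m t
    by (simp_all add: f_def)
  ultimately obtain \<psi> where \<psi>: "\<psi> \<in> hom ?\<Gamma> (jacobi_group 0)"
    "\<And>w. \<psi> (?w w) = word_eval (jacobi_group 0) f w"
    by (rule jacobi.cyclic_free_product_hom_exists) blast
  have "\<forall>x\<in>carrier ?\<Gamma>. \<exists>B d z. det B = 1 \<and> \<psi> x = T_mat 0 B d z"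
    using \<psi>(1) by (auto simp: hom_def carrier_jacobi_group Pi_iff)
  then obtain R D Z where R: "\<And>x. x \<in> carrier ?\<Gamma> \<Longrightarrow> det (R x) = 1"
    and T: "\<And>x. x \<in> carrier ?\<Gamma> \<Longrightarrow> \<psi> x = T_mat 0 (R x) (D x) (Z x)"
    by metis
  interpret \<Gamma>: monoid ?\<Gamma> by (rule monoid_cyclic_free_product)
  have mult: "R (x \<otimes>\<^bsub>?\<Gamma>\<^esub> y) = R x ** R y \<and> D (x \<otimes>\<^bsub>?\<Gamma>\<^esub> y) = D x + R x *v D y"
    if xy: "x \<in> carrier ?\<Gamma>" "y \<in> carrier ?\<Gamma>" for x y
  proof -
    have "T_mat 0 (R (x \<otimes>\<^bsub>?\<Gamma>\<^esub> y)) (D (x \<otimes>\<^bsub>?\<Gamma>\<^esub> y)) (Z (x \<otimes>\<^bsub>?\<Gamma>\<^esub> y))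
      = T_mat 0 (R x) (D x) (Z x) ** T_mat 0 (R y) (D y) (Z y)"
      using hom_mult[OF \<psi>(1) xy] T xy \<Gamma>.m_closed[OF xy] by simp
    then show ?thesis by (simp only: T_mat_mult[OF R[OF xy(1)]] T_mat_eq_iff)
  qed
  have gen: "\<psi> (?w [x]) = f x" for x
    using \<open>range f \<subseteq> _\<close> jacobi.r_one[of "f x" 0] by (simp add: \<psi>(2) image_subset_iff)
  have RD: "R (?w [G1]) = \<rho> (?w [G1])" "R (?w [G2]) = \<rho> (?w [G2])"
     "D (?w [G1]) = d1" "D (?w [G2]) = d2"
    using gen[of G1] gen[of G2] T[of "?w [G1]"] T[of "?w [G2]"]
    by (auto simp: f_def T_mat_eq_iff)
  \<comment> \<open>The linear parts form a homomorphism that agrees with \<open>\<rho>\<close> on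
    generators, hence everywhere; so \<open>D\<close> is a cocycle for
    \<open>\<rho>\<close>.\<close>
  have "R \<in> hom ?\<Gamma> SL2Z" by (rule homI) (use R mult in auto)
  moreover have "(\<lambda>x. R (?w [x])) = (\<lambda>x. \<rho> (?w [x]))"
  proof
    show "R (?w [x]) = \<rho> (?w [x])" for x using RD by (cases x) simp_all
  qed
  ultimately have "R (?w w) = \<rho> (?w w)" for w
    using SL2Z.hom_cyclic_free_product_eval[of R] SL2Z.hom_cyclic_free_product_eval[OF \<rho>] by metis
  moreover have "D (?w (x @ y)) = D (?w x) + R (?w x) *v D (?w y)" for x y
    using mult[of "?w x" "?w y"] by simp
  ultimately have "restrict D (carrier ?\<Gamma>) \<in> carrier (cocycle_group ?\<Gamma> \<rho>)"
    by (auto simp: carrier_cocycle_group)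
  moreover have "restrict D (carrier ?\<Gamma>) (?w [G1]) = d1" "restrict D (carrier ?\<Gamma>) (?w [G2]) = d2"
    using RD by simp_all
  ultimately show ?thesis by blast
qed

section \<open>Square-zero classes and their lifts\<close>

locale jacobi_pair = normalized_pair +
  fixes s :: int and m1 m2 :: nat and \<rho> :: "letter list set \<Rightarrow> int^2^2"
  assumes s: "s \<noteq> 0" and m: "m1 > 0" "m2 > 0"
    and \<rho>: "\<rho> \<in> hom (cyclic_free_product m1 m2) SL2Z"
    and \<rho>_gen: "\<rho> (word_class m1 m2 [G1]) = B1" "\<rho> (word_class m1 m2 [G2]) = B2"
begin

abbreviation "\<Gamma> \<equiv> cyclic_free_product m1 m2"
abbreviation "g1 \<equiv> word_class m1 m2 [G1]"
abbreviation "g2 \<equiv> word_class m1 m2 [G2]"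
abbreviation "Cyc \<equiv> cocycle_group \<Gamma> \<rho>"
abbreviation "Cob \<equiv> coboundaries \<Gamma> \<rho>"

definition K where "K = {d \<in> carrier Cyc. cusp (d g1) (d g2)$2 = 0}"

definition kap where "kap d = kappa (d g1) (d g2)"

sublocale cocycles: comm_group Cyc
  by (rule comm_group_cocycle_group[OF monoid_cyclic_free_product])

lemma cocycle_mult_gen:
  "(d \<otimes>\<^bsub>Cyc\<^esub> e) g1 = d g1 + e g1" "(d \<otimes>\<^bsub>Cyc\<^esub> e) g2 = d g2 + e g2"
  by (simp_all add: mult_cocycle_group)

text \<open>Exhibits the coboundaries as the kernel of \<open>kap\<close> on \<open>K\<close>, so
  that \<open>kap\<close> descends to an injective coordinate on classes.\<close>

lemma coboundaries_iff: "d \<in> Cob \<longleftrightarrow> d \<in> K \<and> kap d = 0"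
proof
  assume "d \<in> Cob"
  then obtain u where u: "d = (\<lambda>x\<in>carrier \<Gamma>. (mat 1 - \<rho> x) *v u)"
    by (auto simp: coboundaries_def)
  then have "d g1 = (mat 1 - B1) *v u" "d g2 = (mat 1 - B2) *v u" by (simp_all add: \<rho>_gen)
  moreover have "d \<in> carrier Cyc"
    unfolding u by (rule coboundary_in_cocycle_group[OF monoid_cyclic_free_product \<rho>])
  ultimately show "d \<in> K \<and> kap d = 0"
    by (simp add: K_def kap_def cusp_coboundary kappa_coboundary)
next
  assume d: "d \<in> K \<and> kap d = 0"
  then obtain u where u: "d g1 = (mat 1 - B1) *v u" "d g2 = (mat 1 - B2) *v u"
    using kappa_zero_imp_coboundary[of "d g1" "d g2"] by (auto simp: K_def kap_def)
  have "d = (\<lambda>x\<in>carrier \<Gamma>. (mat 1 - \<rho> x) *v u)"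
    by (rule cocycle_eqI[OF \<rho>])
      (use d u in \<open>simp_all add: K_def \<rho>_gen
        coboundary_in_cocycle_group[OF monoid_cyclic_free_product \<rho>, simplified]\<close>)
  then show "d \<in> Cob" by (auto simp: coboundaries_def)
qed

lemma subgroup_K: "subgroup K Cyc"
proof (rule cocycles.subgroupI)
  have one: "\<one>\<^bsub>Cyc\<^esub> g1 = 0" "\<one>\<^bsub>Cyc\<^esub> g2 = 0" by (simp_all add: one_cocycle_group)
  then have "\<one>\<^bsub>Cyc\<^esub> \<in> K" using cocycles.one_closed by (simp add: K_def cusp_def)
  then show "K \<noteq> {}" by blast
  show "d \<otimes>\<^bsub>Cyc\<^esub> e \<in> K" if "d \<in> K" "e \<in> K" for d e
    using that cocycles.m_closed[of d e] by (simp add: K_def cocycle_mult_gen cusp_add)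
  show "inv\<^bsub>Cyc\<^esub> d \<in> K" if d: "d \<in> K" for d
  proof -
    have dc: "d \<in> carrier Cyc" using d by (simp add: K_def)
    have "cusp ((inv\<^bsub>Cyc\<^esub> d \<otimes>\<^bsub>Cyc\<^esub> d) g1) ((inv\<^bsub>Cyc\<^esub> d \<otimes>\<^bsub>Cyc\<^esub> d) g2)$2 = 0"
      using one cocycles.l_inv[OF dc] by (simp add: cusp_def)
    then show ?thesis
      using d cocycles.inv_closed[OF dc] by (simp add: K_def cocycle_mult_gen cusp_add)
  qed
qed (auto simp: K_def)

lemma group_hom_kap: "group_hom (Cyc\<lparr>carrier := K\<rparr>) integer_group kap"
proof (intro group_hom.intro group_hom_axioms.intro)
  show "Group.group (Cyc\<lparr>carrier := K\<rparr>)"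
    by (rule subgroup.subgroup_is_group[OF subgroup_K cocycles.group_axioms])
  show "kap \<in> hom (Cyc\<lparr>carrier := K\<rparr>) integer_group"
    by (rule homI) (simp_all add: kap_def cocycle_mult_gen kappa_add)
qed simp

lemma kernel_kap: "kernel (Cyc\<lparr>carrier := K\<rparr>) integer_group kap = Cob"
  using coboundaries_iff by (auto simp: kernel_def)

lemma kap_image: "kap ` carrier (Cyc\<lparr>carrier := K\<rparr>) = carrier integer_group"
proof -
  have "\<exists>d\<in>K. kap d = k" for k
  proof -
    obtain d1 d2 where d: "cusp d1 d2$2 = 0" "kappa d1 d2 = k" using kappa_surj by blast
    have "trace (\<rho> g1) \<noteq> 2" "trace (\<rho> g2) \<noteq> 2"
      using n_pos by (simp_all add: \<rho>_gen trace_eq)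
    from cocycle_exists[OF \<rho> m this, of d1 d2] show ?thesis
      using d by (auto simp: K_def kap_def)
  qed
  then show ?thesis by (auto simp: image_iff) metis
qed

lemma T_mat_cusp:
  "T_mat s (\<rho> g1) d1 z1 ** T_mat s (\<rho> g2) d2 z2
     = T_mat s (U_mat h) (cusp d1 d2) (z1 + z2 + s * wedge d1 (B1 *v d2))"
  by (simp add: \<rho>_gen T_mat_mult det_eq product_eq cusp_def)

lemma coset_in_K_iff:
  assumes "d \<in> Cob #>\<^bsub>Cyc\<^esub> e" "e \<in> carrier Cyc"
  shows "d \<in> K \<longleftrightarrow> e \<in> K"
proof -
  obtain u where u: "u \<in> Cob" "d = u \<otimes>\<^bsub>Cyc\<^esub> e" using assms by (auto simp: r_coset_def)
  then have "u \<in> K" by (simp add: coboundaries_iff)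
  moreover from this have "d \<in> carrier Cyc" using u assms cocycles.m_closed by (simp add: K_def)
  ultimately show ?thesis using u assms by (simp add: K_def cocycle_mult_gen cusp_add)
qed

abbreviation "L \<equiv> square_zero_classes s \<Gamma> \<rho> g1 g2"

text \<open>The square-zero condition quantifies over all representatives and corners. It depends
  only on \<open>cusp\<close>, and \<open>K\<close> is a union of cosets of the
  coboundaries.\<close>

lemma L_eq: "L = (\<lambda>d. Cob #>\<^bsub>Cyc\<^esub> d) ` K"
proof -
  have sq: "(\<forall>z1 z2. let N = unipotent_log (T_mat s (\<rho> g1) (d g1) z1 ** T_mat s (\<rho> g2) (d g2) z2)
         in N ** N = 0) \<longleftrightarrow> cusp (d g1) (d g2)$2 = 0" for d
    using h_pos s by (simp add: T_mat_cusp Let_def unipotent_log_T_mat_U_square)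
  have self: "d \<in> Cob #>\<^bsub>Cyc\<^esub> d" if "d \<in> carrier Cyc" for d
  proof -
    have "\<one>\<^bsub>Cyc\<^esub> \<in> Cob"
      using subgroup.one_closed[OF group_hom.subgroup_kernel[OF group_hom_kap]] by (simp add: kernel_kap)
    then show ?thesis using that unfolding r_coset_def by force
  qed
  have H1: "carrier (H1 \<Gamma> \<rho>) = (\<lambda>d. Cob #>\<^bsub>Cyc\<^esub> d) ` carrier Cyc"
    by (auto simp: H1_def carrier_FactGroup)
  have sub: "Cob #>\<^bsub>Cyc\<^esub> e \<subseteq> carrier Cyc" if "e \<in> carrier Cyc" for e
    by (rule cocycles.r_coset_subset_G) (use that coboundaries_iff in \<open>auto simp: K_def\<close>)
  show ?thesis
  proof
    show "L \<subseteq> (\<lambda>d. Cob #>\<^bsub>Cyc\<^esub> d) ` K"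
      unfolding square_zero_classes_def sq H1 using self by (auto simp: K_def)
    show "(\<lambda>d. Cob #>\<^bsub>Cyc\<^esub> d) ` K \<subseteq> L"
    proof
      fix C assume "C \<in> (\<lambda>d. Cob #>\<^bsub>Cyc\<^esub> d) ` K"
      then obtain e where e: "e \<in> K" "C = Cob #>\<^bsub>Cyc\<^esub> e" by blast
      then have ec: "e \<in> carrier Cyc" by (simp add: K_def)
      have "d \<in> K" if "d \<in> C" for d using coset_in_K_iff[of d e] that e ec by simp
      then show "C \<in> L"
        unfolding square_zero_classes_def sq H1 using ec e(2) by (auto simp: K_def)
    qed
  qed
qed

text \<open>Presents the square-zero classes as a quotient of \<open>K\<close>, to which the first
  isomorphism theorem for \<open>kap\<close> applies.\<close>

lemma H1_restrict: "(H1 \<Gamma> \<rho>)\<lparr>carrier := L\<rparr> = (Cyc\<lparr>carrier := K\<rparr>) Mod Cob"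
  unfolding L_eq by (auto simp: H1_def FactGroup_def RCOSETS_def r_coset_def set_mult_def fun_eq_iff)

lemma iso_kap: "(\<lambda>C. the_elem (kap ` C)) \<in> iso ((H1 \<Gamma> \<rho>)\<lparr>carrier := L\<rparr>) integer_group"
  using group_hom.FactGroup_iso_set[OF group_hom_kap kap_image]
  by (simp only: kernel_kap H1_restrict)

lemma group_L: "Group.group ((H1 \<Gamma> \<rho>)\<lparr>carrier := L\<rparr>)"
  using normal.factorgroup_is_group[OF group_hom.normal_kernel[OF group_hom_kap]]
  by (simp only: kernel_kap H1_restrict)

lemma subgroup_L: "subgroup L (H1 \<Gamma> \<rho>)"
proof -
  have "subgroup Cob (Cyc\<lparr>carrier := K\<rparr>)"
    using group_hom.subgroup_kernel[OF group_hom_kap] by (simp only: kernel_kap)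
  then have "subgroup Cob Cyc" by (rule cocycles.incl_subgroup[OF subgroup_K])
  then have "Cob \<lhd> Cyc" by (simp add: cocycles.normal_iff_subgroup)
  then have "Group.group (H1 \<Gamma> \<rho>)" unfolding H1_def by (rule normal.factorgroup_is_group)
  then show ?thesis
    by (rule group.group_incl_imp_subgroup) (use group_L in \<open>auto simp: square_zero_classes_def\<close>)
qed

lemma class_rep:
  assumes "C \<in> L" "d \<in> C"
  shows "d \<in> K" "the_elem (kap ` C) = kap d"
proof -
  obtain e where e: "e \<in> K" "C = Cob #>\<^bsub>Cyc\<^esub> e" using assms(1) unfolding L_eq by blast
  then have ec: "e \<in> carrier Cyc" by (simp add: K_def)
  show "d \<in> K" using coset_in_K_iff[of d e] e ec assms(2) by simp
  have "kap x = kap e" if "x \<in> C" for x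
    using that unfolding e(2) r_coset_def
    by (auto simp: coboundaries_iff kap_def cocycle_mult_gen kappa_add)
  then show "the_elem (kap ` C) = kap d" using assms(2) by (intro the_elem_image_unique) auto
qed

lemma class_nonempty: "C \<in> L \<Longrightarrow> \<exists>d. d \<in> C"
  using group_hom.FactGroup_nonempty[OF group_hom_kap, of C]
  by (auto simp: kernel_kap simp flip: H1_restrict)

end

section \<open>Divisibility, and independence of the choice of primitive coordinate\<close>

lemma of_int_divide_in_Ints_iff:
  fixes a b :: int
  assumes "b \<noteq> 0"
  shows "(of_int a / of_int b :: rat) \<in> \<int> \<longleftrightarrow> b dvd a"
proof
  assume "(of_int a / of_int b :: rat) \<in> \<int>"
  then obtain n where "(of_int a / of_int b :: rat) = of_int n" by (auto elim: Ints_cases)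
  then have "(of_int a :: rat) = of_int (b * n)" using assms by (simp add: field_simps)
  then show "b dvd a" unfolding of_int_eq_iff by simp
qed (rule of_int_divide_in_Ints)

text \<open>Two coordinates differ by an automorphism \<open>f\<close> of the integers;
  \<open>f\<close> is multiplication by \<open>f 1\<close>, and surjectivity makes
  \<open>f 1\<close> a unit.\<close>

lemma iso_integer_group_square_unique:
  assumes "Group.group G" and e: "e \<in> iso G integer_group" and k: "k \<in> iso G integer_group"
    and x: "x \<in> carrier G"
  shows "(k x)\<^sup>2 = (e x)\<^sup>2"
proof -
  interpret group G by fact
  have inv: "inv_into (carrier G) e \<in> iso integer_group G"
    using iso_set_sym[OF e] .
  define f where "f = (\<lambda>n. k (inv_into (carrier G) e n))"
  have f: "f \<in> iso integer_group integer_group"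
    using iso_set_trans[OF inv k] by (simp add: f_def comp_def)
  have add: "f (a + b) = f a + f b" for a b
    using hom_mult[of f integer_group integer_group a b] f by (simp add: iso_def)
  have f0: "f 0 = 0" using add[of 0 0] by simp
  have neg: "f (- a) = - f a" for a using add[of a "- a"] f0 by simp
  have nat: "f (int n) = int n * f 1" for n
    by (induction n) (simp_all add: f0 add algebra_simps)
  have lin: "f n = n * f 1" for n
    by (cases n rule: int_cases2) (simp_all add: nat neg)
  obtain n where "f n = 1" using f unfolding iso_def bij_betw_def by (metis (mono_tags, lifting) UNIV_I carrier_integer_group imageE mem_Collect_eq)
  then have "\<bar>f 1\<bar> = 1" using lin[of n] by (auto simp: zmult_eq_1_iff)
  then have "(f 1)\<^sup>2 = 1" by (simp add: power2_eq_1_iff abs_if split: if_splits)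
  moreover have "k x = f (e x)"
    using e x by (simp add: f_def iso_def bij_betw_def)
  ultimately show ?thesis by (simp add: lin[of "e x"] power_mult_distrib)
qed

section \<open>Integral lifts and their cusp monodromy\<close>

context jacobi_pair
begin

abbreviation "heights d z1 z2 \<equiv>
   (2 - t1) * z1 = s * wedge (adj2 (mat 1 - B1) *v d g1) (d g1) \<and>
   (2 - t2) * z2 = s * wedge (adj2 (mat 1 - B2) *v d g2) (d g2)"

text \<open>Both generators are treated at once; the relation \<open>B^n = 1\<close> is inherited
  from \<open>\<rho>\<close> being a homomorphism.\<close>

lemma T_mat_pow_gen:
  assumes B: "i = G1 \<and> B = B1 \<and> t = t1 \<and> n = m1 \<or> i = G2 \<and> B = B2 \<and> t = t2 \<and> n = m2"
  shows "T_mat s B d z [^]\<^bsub>jacobi_group s\<^esub> n = mat 1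
     \<longleftrightarrow> (2 - t) * z = s * wedge (adj2 (mat 1 - B) *v d) d"
  using B SL2Z.hom_cyclic_free_product_pow[OF \<rho>] m det_eq n_pos
    T_mat_pow_eq_one_iff[of B n s d z]
  by (auto simp: \<rho>_gen trace_eq)

lemma integral_lift_heights:
  assumes "integral_lift s \<Gamma> \<rho> g1 g2 C \<phi>"
  obtains d z1 z2 where "d \<in> C" "heights d z1 z2"
    "\<phi> g1 = T_mat s (\<rho> g1) (d g1) z1" "\<phi> g2 = T_mat s (\<rho> g2) (d g2) z2"
proof -
  obtain d z1 z2 where \<phi>: "\<phi> \<in> hom \<Gamma> (jacobi_group s)" and d: "d \<in> C"
    "\<phi> g1 = T_mat s (\<rho> g1) (d g1) z1" "\<phi> g2 = T_mat s (\<rho> g2) (d g2) z2"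
    using assms by (auto simp: integral_lift_def)
  have "heights d z1 z2"
    using jacobi.hom_cyclic_free_product_pow[OF \<phi>]
      T_mat_pow_gen[of G1 B1 t1 m1 "d g1" z1] T_mat_pow_gen[of G2 B2 t2 m2 "d g2" z2]
    by (simp add: d \<rho>_gen)
  then show thesis using that d by blast
qed

lemma heights_integral_lift:
  assumes d: "d \<in> C" and z: "heights d z1 z2"
  shows "\<exists>\<phi>. integral_lift s \<Gamma> \<rho> g1 g2 C \<phi>"
proof -
  define f where "f = case_letter (T_mat s B1 (d g1) z1) (T_mat s B2 (d g2) z2)"
  have "f x \<in> carrier (jacobi_group s)" for x
    unfolding carrier_jacobi_group f_def using det_eq by (cases x) auto
  then have f: "range f \<subseteq> carrier (jacobi_group s)" by blast
  moreover have "f G1 [^]\<^bsub>jacobi_group s\<^esub> m1 = \<one>\<^bsub>jacobi_group s\<^esub>"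
    "f G2 [^]\<^bsub>jacobi_group s\<^esub> m2 = \<one>\<^bsub>jacobi_group s\<^esub>"
    using z T_mat_pow_gen[of G1 B1 t1 m1 "d g1" z1] T_mat_pow_gen[of G2 B2 t2 m2 "d g2" z2]
    by (simp_all add: f_def)
  ultimately obtain \<phi> where \<phi>: "\<phi> \<in> hom \<Gamma> (jacobi_group s)"
    "\<And>w. \<phi> (word_class m1 m2 w) = word_eval (jacobi_group s) f w"
    by (rule jacobi.cyclic_free_product_hom_exists) blast
  have gen: "\<phi> (word_class m1 m2 [x]) = f x" for x
    using f jacobi.r_one[of "f x" s] by (simp add: \<phi>(2) image_subset_iff)
  show ?thesis
    unfolding integral_lift_def using \<phi>(1) d gen[of G1] gen[of G2]
    by (intro exI[of _ \<phi>]) (auto simp: f_def \<rho>_gen)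
qed

definition \<nu> where "\<nu> = \<bar>det (mat 1 - B1) * det (mat 1 - B2)\<bar>"

lemma \<nu>_eq: "\<nu> = (2 - t1) * (2 - t2)" "\<nu> > 0"
proof -
  show "\<nu> = (2 - t1) * (2 - t2)"
    using n_pos by (simp add: \<nu>_def det_mat1_minus det_eq trace_eq abs_mult)
  then show "\<nu> > 0" using n_pos by simp
qed

lemma coordinate_square:
  assumes "k \<in> iso ((H1 \<Gamma> \<rho>)\<lparr>carrier := L\<rparr>) integer_group" "C \<in> L" "d \<in> C"
  shows "(k C)\<^sup>2 = (kappa (d g1) (d g2))\<^sup>2"
  using iso_integer_group_square_unique[OF group_L iso_kap assms(1), of C] assms(2)
    class_rep(2)[OF assms(2,3)] by (simp add: kap_def)

lemma integral_lift_iff: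
  assumes k: "k \<in> iso ((H1 \<Gamma> \<rho>)\<lparr>carrier := L\<rparr>) integer_group" and C: "C \<in> L"
  shows "(\<exists>\<phi>. integral_lift s \<Gamma> \<rho> g1 g2 C \<phi>) \<longleftrightarrow> (of_int (s * (k C)\<^sup>2) / of_int \<nu> :: rat) \<in> \<int>"
proof -
  \<comment> \<open>Solvability depends on \<open>d\<close> only through the square of
    \<open>kappa\<close>, so it is the same for every representative of the class.\<close>
  have exists: "(\<exists>z1 z2. heights d z1 z2) \<longleftrightarrow> \<nu> dvd s * (k C)\<^sup>2" if d: "d \<in> C" for d
    using exists_heights_iff[of "d g1" "d g2" s] class_rep(1)[OF C d]
    by (simp add: K_def coordinate_square[OF k C d] \<nu>_eq)
  have "(\<exists>\<phi>. integral_lift s \<Gamma> \<rho> g1 g2 C \<phi>) \<longleftrightarrow> \<nu> dvd s * (k C)\<^sup>2"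
    using exists integral_lift_heights heights_integral_lift class_nonempty[OF C] by metis
  also have "\<dots> \<longleftrightarrow> (of_int (s * (k C)\<^sup>2) / of_int \<nu> :: rat) \<in> \<int>"
    using \<nu>_eq(2) by (intro of_int_divide_in_Ints_iff[symmetric]) simp
  finally show ?thesis .
qed

text \<open>The minor \<open>D\<close> of the logarithm satisfies
  \<open>\<nu> * D = s * (k C)^2\<close>; both rank and index are read off from
  \<open>D\<close>.\<close>

lemma lift_monodromy:
  assumes k: "k \<in> iso ((H1 \<Gamma> \<rho>)\<lparr>carrier := L\<rparr>) integer_group" and C: "C \<in> L"
    and lift: "integral_lift s \<Gamma> \<rho> g1 g2 C \<phi>" and N: "N = unipotent_log (\<phi> g1 ** \<phi> g2)"
  shows "k C \<noteq> 0 \<Longrightarrow> rank N = 2 \<and>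
               (\<exists>r. has_finite_index (image_lattice N)
                      (additive_group_on (saturated_image_lattice N)) r \<and>
                    (of_nat r :: rat) = \<bar>of_int (s * (k C)\<^sup>2) / of_int \<nu>\<bar>)"
    and "k C = 0 \<Longrightarrow> rank N = 1"
proof -
  obtain d z1 z2 where d: "d \<in> C" and z: "heights d z1 z2"
    and \<phi>: "\<phi> g1 = T_mat s (\<rho> g1) (d g1) z1" "\<phi> g2 = T_mat s (\<rho> g2) (d g2) z2"
    using lift by (rule integral_lift_heights)
  have cusp: "cusp (d g1) (d g2)$2 = 0" using class_rep(1)[OF C d] by (simp add: K_def)
  define p where "p = cusp (d g1) (d g2)$1"
  define y where "y = z1 + z2 + s * wedge (d g1) (B1 *v d g2)"
  define D where "D = s * p * p - y * h"
  have D: "D = s * p\<^sup>2 - y * h" by (simp add: D_def power2_eq_square)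
  have N_eq: "N = cusp_block (of_int (s * p)) (of_int y) (of_int h) (of_int p)"
    unfolding N \<phi> T_mat_cusp y_def[symmetric] p_def by (rule unipotent_log_T_mat_U[OF cusp])
  have \<nu>D: "\<nu> * D = s * (k C)\<^sup>2"
    using minor_eq_kappa_square[OF cusp _ _ y_def p_def] z
    unfolding D coordinate_square[OF k C d] \<nu>_eq by blast
  have rank: "rank N = (if D = 0 then 1 else 2)"
  proof -
    have "(of_int (s * p) :: rat) * of_int p = of_int y * of_int h \<longleftrightarrow> D = 0"
      unfolding of_int_mult[symmetric] of_int_eq_iff by (simp add: D_def)
    then show ?thesis unfolding N_eq using h_pos by (simp add: rank_cusp_block)
  qed
  have D0: "D = 0 \<longleftrightarrow> k C = 0" using \<nu>D \<nu>_eq(2) s by auto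
  show "rank N = 1" if "k C = 0" using rank D0 that by simp
  show "rank N = 2 \<and> (\<exists>r. has_finite_index (image_lattice N)
                      (additive_group_on (saturated_image_lattice N)) r \<and>
                    (of_nat r :: rat) = \<bar>of_int (s * (k C)\<^sup>2) / of_int \<nu>\<bar>)" if "k C \<noteq> 0"
  proof -
    have "has_finite_index (image_lattice N) (additive_group_on (saturated_image_lattice N)) (nat \<bar>D\<bar>)"
      unfolding N_eq D_def by (rule index_cusp_block) (use D0 that in \<open>simp add: D_def\<close>)
    moreover have "(of_nat (nat \<bar>D\<bar>) :: rat) = \<bar>of_int (s * (k C)\<^sup>2) / of_int \<nu>\<bar>"
      using \<nu>_eq(2) by (simp flip: \<nu>D)
    ultimately show ?thesis using rank D0 that by auto
  qed
qed

end

theorem theorem1p1: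
  shows
  "((\<forall>B1 B2 h. noncentral_finite_order B1 \<and> noncentral_finite_order B2 \<and> h \<ge> 1 \<and>
        conjugate_SL2Z (B1 ** B2) (U_mat h) \<longrightarrow>
        (\<exists>B1' B2'. pair_equiv (B1, B2) (B1', B2') \<and>
           (group.ord SL2Z B1', group.ord SL2Z B2', h) \<in> {(3, 4, 1), (4, 6, 1), (3, 6, 2)}) \<and>
        h \<le> 2) \<and>
    (\<forall>(m1, m2, h) \<in> {(3, 4, 1), (4, 6, 1), (3, 6, 2)}.
        \<exists>B1 B2. noncentral_finite_order B1 \<and> noncentral_finite_order B2 \<and>
          conjugate_SL2Z (B1 ** B2) (U_mat h) \<and>
          group.ord SL2Z B1 = m1 \<and> group.ord SL2Z B2 = m2)) \<and>
   (\<forall>(s::int) B1 B2 (h::int) m1 m2 \<Gamma> g1 g2 \<rho> L (\<nu>::int).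
      s \<noteq> 0 \<and> noncentral_finite_order B1 \<and> noncentral_finite_order B2 \<and> h \<ge> 1 \<and> B1 ** B2 = U_mat h \<and>
      m1 = group.ord SL2Z B1 \<and> m2 = group.ord SL2Z B2 \<and>
      \<Gamma> = cyclic_free_product m1 m2 \<and> g1 = word_class m1 m2 [G1] \<and> g2 = word_class m1 m2 [G2] \<and>
      \<rho> \<in> hom \<Gamma> SL2Z \<and> \<rho> g1 = B1 \<and> \<rho> g2 = B2 \<and>
      L = square_zero_classes s \<Gamma> \<rho> g1 g2 \<and>
      \<nu> = \<bar>det (mat 1 - B1) * det (mat 1 - B2)\<bar> \<longrightarrow>
      subgroup L (H1 \<Gamma> \<rho>) \<and> (H1 \<Gamma> \<rho>)\<lparr>carrier := L\<rparr> \<cong> integer_group \<and>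
      (\<forall>k \<in> iso ((H1 \<Gamma> \<rho>)\<lparr>carrier := L\<rparr>) integer_group. \<forall>c\<in>L.
         ((\<exists>\<phi>. integral_lift s \<Gamma> \<rho> g1 g2 c \<phi>) \<longleftrightarrow>
            (of_int (s * (k c)\<^sup>2) / of_int \<nu> :: rat) \<in> \<int>) \<and>
         (\<forall>\<phi> N. integral_lift s \<Gamma> \<rho> g1 g2 c \<phi> \<and> N = unipotent_log (\<phi> g1 ** \<phi> g2) \<longrightarrow>
            (k c \<noteq> 0 \<longrightarrow> rank N = 2 \<and>
               (\<exists>r. has_finite_index (image_lattice N)
                      (additive_group_on (saturated_image_lattice N)) r \<and>
                    (of_nat r :: rat) = \<bar>of_int (s * (k c)\<^sup>2) / of_int \<nu>\<bar>)) \<and>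
            (k c = 0 \<longrightarrow> rank N = 1))))"
proof (intro conjI)
  show "\<forall>B1 B2 h. noncentral_finite_order B1 \<and> noncentral_finite_order B2 \<and> h \<ge> 1 \<and>
        conjugate_SL2Z (B1 ** B2) (U_mat h) \<longrightarrow>
        (\<exists>B1' B2'. pair_equiv (B1, B2) (B1', B2') \<and>
           (SL2Z.ord B1', SL2Z.ord B2', h) \<in> {(3, 4, 1), (4, 6, 1), (3, 6, 2)}) \<and> h \<le> 2"
  proof (intro allI impI)
    fix B1 B2 h
    assume "noncentral_finite_order B1 \<and> noncentral_finite_order B2 \<and> h \<ge> 1 \<and>
        conjugate_SL2Z (B1 ** B2) (U_mat h)"
    then have "(SL2Z.ord B1, SL2Z.ord B2, h) \<in> {(3, 4, 1), (4, 6, 1), (3, 6, 2)} \<or>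
         (SL2Z.ord B2, SL2Z.ord B1, h) \<in> {(3, 4, 1), (4, 6, 1), (3, 6, 2)}"
      using elliptic_pair_classification by blast
    \<comment> \<open>The classification leaves open only which factor comes first; one interchange
      sorts the two orders.\<close>
    moreover have "pair_equiv (B1, B2) (B1, B2)" "pair_equiv (B1, B2) (B2, B1)"
      unfolding pair_equiv_def by (auto intro: pair_move.interchange)
    moreover have "h \<le> 2" using calculation(1) by auto
    ultimately show "(\<exists>B1' B2'. pair_equiv (B1, B2) (B1', B2') \<and>
           (SL2Z.ord B1', SL2Z.ord B2', h) \<in> {(3, 4, 1), (4, 6, 1), (3, 6, 2)}) \<and> h \<le> 2"
      by blast
  qed
  show "\<forall>(m1, m2, h) \<in> {(3, 4, 1), (4, 6, 1), (3, 6, 2)}.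
        \<exists>B1 B2. noncentral_finite_order B1 \<and> noncentral_finite_order B2 \<and>
          conjugate_SL2Z (B1 ** B2) (U_mat h) \<and> SL2Z.ord B1 = m1 \<and> SL2Z.ord B2 = m2"
    using elliptic_pair_examples by blast
next
  show "\<forall>(s::int) B1 B2 (h::int) m1 m2 \<Gamma> g1 g2 \<rho> L (\<nu>::int).
      s \<noteq> 0 \<and> noncentral_finite_order B1 \<and> noncentral_finite_order B2 \<and> h \<ge> 1 \<and> B1 ** B2 = U_mat h \<and>
      m1 = SL2Z.ord B1 \<and> m2 = SL2Z.ord B2 \<and>
      \<Gamma> = cyclic_free_product m1 m2 \<and> g1 = word_class m1 m2 [G1] \<and> g2 = word_class m1 m2 [G2] \<and>
      \<rho> \<in> hom \<Gamma> SL2Z \<and> \<rho> g1 = B1 \<and> \<rho> g2 = B2 \<and>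
      L = square_zero_classes s \<Gamma> \<rho> g1 g2 \<and>
      \<nu> = \<bar>det (mat 1 - B1) * det (mat 1 - B2)\<bar> \<longrightarrow>
      subgroup L (H1 \<Gamma> \<rho>) \<and> (H1 \<Gamma> \<rho>)\<lparr>carrier := L\<rparr> \<cong> integer_group \<and>
      (\<forall>k \<in> iso ((H1 \<Gamma> \<rho>)\<lparr>carrier := L\<rparr>) integer_group. \<forall>c\<in>L.
         ((\<exists>\<phi>. integral_lift s \<Gamma> \<rho> g1 g2 c \<phi>) \<longleftrightarrow>
            (of_int (s * (k c)\<^sup>2) / of_int \<nu> :: rat) \<in> \<int>) \<and>
         (\<forall>\<phi> N. integral_lift s \<Gamma> \<rho> g1 g2 c \<phi> \<and> N = unipotent_log (\<phi> g1 ** \<phi> g2) \<longrightarrow>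
            (k c \<noteq> 0 \<longrightarrow> rank N = 2 \<and>
               (\<exists>r. has_finite_index (image_lattice N)
                      (additive_group_on (saturated_image_lattice N)) r \<and>
                    (of_nat r :: rat) = \<bar>of_int (s * (k c)\<^sup>2) / of_int \<nu>\<bar>)) \<and>
            (k c = 0 \<longrightarrow> rank N = 1)))"
  proof (intro allI impI)
    fix s B1 B2 h m1 m2 \<Gamma> g1 g2 \<rho> L \<nu>
    assume H: "s \<noteq> 0 \<and> noncentral_finite_order B1 \<and> noncentral_finite_order B2 \<and> h \<ge> 1 \<and> B1 ** B2 = U_mat h \<and>
      m1 = SL2Z.ord B1 \<and> m2 = SL2Z.ord B2 \<and>
      \<Gamma> = cyclic_free_product m1 m2 \<and> g1 = word_class m1 m2 [G1] \<and> g2 = word_class m1 m2 [G2] \<and>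
      \<rho> \<in> hom \<Gamma> SL2Z \<and> \<rho> g1 = B1 \<and> \<rho> g2 = B2 \<and>
      L = square_zero_classes s \<Gamma> \<rho> g1 g2 \<and>
      \<nu> = \<bar>det (mat 1 - B1) * det (mat 1 - B2)\<bar>"
    then have fin: "noncentral_finite_order B1" "noncentral_finite_order B2" and h: "h \<ge> 1"
      and U: "B1 ** B2 = U_mat h" by blast+
    have \<Gamma>: "\<Gamma> = cyclic_free_product m1 m2" and g: "g1 = word_class m1 m2 [G1]" "g2 = word_class m1 m2 [G2]"
      and L: "L = square_zero_classes s \<Gamma> \<rho> g1 g2"
      and \<nu>: "\<nu> = \<bar>det (mat 1 - B1) * det (mat 1 - B2)\<bar>" using H by blast+
    note d = noncentral_finite_order_trace[OF fin(1)] noncentral_finite_order_trace[OF fin(2)]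
    \<comment> \<open>The normal form supplies the parameters \<open>a\<close> and \<open>c\<close>
      under which the locale results apply to the given pair.\<close>
    obtain a c where "normalized_pair B1 B2 h a c (trace B1) (trace B2)"
      by (rule elliptic_pair_normal_form[OF d(1,3,2,4) U h]) (blast intro: normalized_pair.intro)
    then interpret J: jacobi_pair B1 B2 h a c "trace B1" "trace B2" s m1 m2 \<rho>
      using H ord_pos[OF d(1,2)] ord_pos[OF d(3,4)]
      by (intro jacobi_pair.intro jacobi_pair_axioms.intro) blast+
    have "\<nu> = J.\<nu>" unfolding \<nu> J.\<nu>_def ..
    show "subgroup L (H1 \<Gamma> \<rho>) \<and> (H1 \<Gamma> \<rho>)\<lparr>carrier := L\<rparr> \<cong> integer_group \<and>
      (\<forall>k \<in> iso ((H1 \<Gamma> \<rho>)\<lparr>carrier := L\<rparr>) integer_group. \<forall>c\<in>L.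
         ((\<exists>\<phi>. integral_lift s \<Gamma> \<rho> g1 g2 c \<phi>) \<longleftrightarrow>
            (of_int (s * (k c)\<^sup>2) / of_int \<nu> :: rat) \<in> \<int>) \<and>
         (\<forall>\<phi> N. integral_lift s \<Gamma> \<rho> g1 g2 c \<phi> \<and> N = unipotent_log (\<phi> g1 ** \<phi> g2) \<longrightarrow>
            (k c \<noteq> 0 \<longrightarrow> rank N = 2 \<and>
               (\<exists>r. has_finite_index (image_lattice N)
                      (additive_group_on (saturated_image_lattice N)) r \<and>
                    (of_nat r :: rat) = \<bar>of_int (s * (k c)\<^sup>2) / of_int \<nu>\<bar>)) \<and>
            (k c = 0 \<longrightarrow> rank N = 1)))"
      unfolding L \<Gamma> g \<open>\<nu> = J.\<nu>\<close>
    proof (intro conjI ballI allI impI)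
      show "subgroup J.L (H1 J.\<Gamma> \<rho>)" by (rule J.subgroup_L)
      show "(H1 J.\<Gamma> \<rho>)\<lparr>carrier := J.L\<rparr> \<cong> integer_group"
        using J.iso_kap unfolding is_iso_def by blast
    next
      fix k C
      assume k: "k \<in> iso ((H1 J.\<Gamma> \<rho>)\<lparr>carrier := J.L\<rparr>) integer_group" and C: "C \<in> J.L"
      show "(\<exists>\<phi>. integral_lift s J.\<Gamma> \<rho> J.g1 J.g2 C \<phi>) \<longleftrightarrow>
            (of_int (s * (k C)\<^sup>2) / of_int J.\<nu> :: rat) \<in> \<int>"
        by (rule J.integral_lift_iff[OF k C])
      fix \<phi> N
      assume "integral_lift s J.\<Gamma> \<rho> J.g1 J.g2 C \<phi> \<and> N = unipotent_log (\<phi> J.g1 ** \<phi> J.g2)"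
      note monodromy = J.lift_monodromy[OF k C this[THEN conjunct1] this[THEN conjunct2]]
      show "rank N = 2" "\<exists>r. has_finite_index (image_lattice N)
                      (additive_group_on (saturated_image_lattice N)) r \<and>
                    (of_nat r :: rat) = \<bar>of_int (s * (k C)\<^sup>2) / of_int J.\<nu>\<bar>" if "k C \<noteq> 0"
        using monodromy(1)[OF that] by blast+
      show "rank N = 1" if "k C = 0" by (rule monodromy(2)[OF that])
    qed
  qed
qed

end
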